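(* Let $X$ be a Hilbert space with norm $\|\cdot\|$ and let $\mathcal J:X\to[0,\infty]$ be convex, lower semicontinuous, positively homogeneous of degree 1 (i.e. $\mathcal J(\lambda u)=\lambda\mathcal J(u)$ for all $\lambda>0$, $u\in X$), with dense domain $\{u\in X:\mathcal J(u)<\infty\}$. Set $\mathcal E(t,u)=t\,\mathcal J(u)$. Then for every $u^0\in X$ with $\mathcal J(u^0)<\infty$ there exists exactly one left-continuous energetic solution $u:[0,\infty)\to X$ of the energetic rate-independent system $(X,\mathcal E,\|\cdot\|)$ with $u(0)=u^0$.
   Context: Convention: $0\cdot\infty=0$ (so $\mathcal E(0,u)=0$ for all $u\in X$). Variation: for $u:[0,\infty)\to X$ and $0\le r<t$, $\mathrm{Var}_{\|\cdot\|}(u;[r,t])=\sup\{\sum_{j=1}^N\|u(t_j)-u(t_{j-1})\| : N\in\mathbb N,\ r\le t_0<t_1<\dots<t_N\le t\}$. Energetic solution: $u:[0,\infty)\to X$ is an energetic solution for $(X,\mathcal E,\|\cdot\|)$ with $\mathcal E(t,u)=t\mathcal J(u)$ if $t\mapsto\mathcal J(u(t))$ lies in $L^1_{\mathrm{loc}}([0,\infty))$ (in particular it is integrable near $0$) and, for all $r,t\ge0$ with $r<t$ in (E) and all $t\ge 0$ in (S): (S) for all $\tilde u\in X$: $t\mathcal J(u(t))\le t\mathcal J(\tilde u)+\|\tilde u-u(t)\|$; (E) $t\mathcal J(u(t))+\mathrm{Var}_{\|\cdot\|}(u;[r,t])=r\mathcal J(u(r))+\int_r^t\mathcal J(u(\tau))\,d\tau$;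 (I) $u(0)=u(0^+):=\lim_{\tau\to0^+}u(\tau)$ in the norm topology. Left-continuous means $u(t)=u(t^-):=\lim_{\tau\to t^-}u(\tau)$ for all $t>0$. *)

theory Defs
  imports "HOL-Analysis.Analysis"
begin

text \<open>
  Functionals with values in \<open>[0, \<infinity>]\<close> have type \<^typ>\<open>'a \<Rightarrow> ennreal\<close>. Multiplication on
  \<^typ>\<open>ennreal\<close> satisfies \<open>0 * \<infinity> = 0\<close>, which is the convention used throughout.
\<close>

definition convex_functional :: "('a::real_vector \<Rightarrow> ennreal) \<Rightarrow> bool" where
  "convex_functional J \<longleftrightarrow>
     (\<forall>x y a b. a \<ge> 0 \<longrightarrow> b \<ge> 0 \<longrightarrow> a + b = 1 \<longrightarrow>
        J (a *\<^sub>R x + b *\<^sub>R y) \<le> ennreal a * J x + ennreal b * J y)"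

definition lower_semicontinuous :: "('a::topological_space \<Rightarrow> ennreal) \<Rightarrow> bool" where
  "lower_semicontinuous J \<longleftrightarrow> (\<forall>x. J x \<le> Liminf (at x) J)"

definition pos_homogeneous :: "('a::real_vector \<Rightarrow> ennreal) \<Rightarrow> bool" where
  "pos_homogeneous J \<longleftrightarrow> (\<forall>c x. c > 0 \<longrightarrow> J (c *\<^sub>R x) = ennreal c * J x)"

definition eff_domain :: "('a \<Rightarrow> ennreal) \<Rightarrow> 'a set" where
  "eff_domain J = {x. J x < \<infinity>}"

definition energy :: "('a \<Rightarrow> ennreal) \<Rightarrow> real \<Rightarrow> 'a \<Rightarrow> ennreal" where
  "energy J t x = ennreal t * J x"

definition variation :: "(real \<Rightarrow> 'a::real_normed_vector) \<Rightarrow> real \<Rightarrow> real \<Rightarrow> ennreal" where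
  "variation u r t =
     Sup {(\<Sum>j=1..N. ennreal (norm (u (s j) - u (s (j - 1))))) | (N::nat) (s::nat \<Rightarrow> real).
            r \<le> s 0 \<and> strict_mono_on {0..N} s \<and> s N \<le> t}"

text \<open>
  Membership in \<open>L\<^sup>1\<^sub>l\<^sub>o\<^sub>c([0,\<infinity>))\<close>: the compact sets range over subsets of the closed half-line,
  so integrability up to and including time 0 is required.
\<close>

definition L1_loc :: "(real \<Rightarrow> ennreal) \<Rightarrow> bool" where
  "L1_loc f \<longleftrightarrow>
     f \<in> borel_measurable (lebesgue_on {0..}) \<and>
     (\<forall>K. compact K \<longrightarrow> K \<subseteq> {0..} \<longrightarrow> (\<integral>\<^sup>+\<tau>. f \<tau> \<partial>lebesgue_on K) < \<infinity>)"

text \<open>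
  Curves \<open>u : [0,\<infinity>) \<rightarrow> X\<close> are functions on \<^typ>\<open>real\<close> of which only the values on \<open>{0..}\<close> matter.
  The four conjuncts of \<open>energetic_solution\<close> are the integrability requirement, stability (S), the
  energy balance (E), and the initial condition (I). In (E) the integrand is the partial time
  derivative of the energy, which for \<open>E(t,x) = t J(x)\<close> is \<open>J(x)\<close>; both sides are sums in
  \<open>[0,\<infinity>]\<close>, so no subtraction of infinite values occurs.
\<close>

definition stable :: "('a::real_normed_vector \<Rightarrow> ennreal) \<Rightarrow> (real \<Rightarrow> 'a) \<Rightarrow> bool" where
  "stable J u \<longleftrightarrow>
     (\<forall>t\<ge>0. \<forall>v. energy J t (u t) \<le> energy J t v + ennreal (norm (v - u t)))"

definition energy_balance :: "('a::real_normed_vector \<Rightarrow> ennreal) \<Rightarrow> (real \<Rightarrow> 'a) \<Rightarrow> bool" where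
  "energy_balance J u \<longleftrightarrow>
     (\<forall>r\<ge>0. \<forall>t>r. energy J t (u t) + variation u r t =
        energy J r (u r) + (\<integral>\<^sup>+\<tau>. J (u \<tau>) \<partial>lebesgue_on {r..t}))"

definition energetic_solution :: "('a::real_normed_vector \<Rightarrow> ennreal) \<Rightarrow> (real \<Rightarrow> 'a) \<Rightarrow> bool" where
  "energetic_solution J u \<longleftrightarrow>
     L1_loc (\<lambda>t. J (u t)) \<and> stable J u \<and> energy_balance J u \<and> (u \<longlongrightarrow> u 0) (at_right 0)"

definition left_continuous :: "(real \<Rightarrow> 'a::topological_space) \<Rightarrow> bool" where
  "left_continuous u \<longleftrightarrow> (\<forall>t>0. (u \<longlongrightarrow> u t) (at_left t))"

end

theory Submission
  imports Defs "HOL-Complex_Analysis.Great_Picard"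
begin

text \<open>
  Write \<open>j(t) = J(u(t))\<close>. Everything rests on replacing the energy balance by a statement about
  pairs of times. A curve that is stable and satisfies the energy balance also satisfies
  \<open>\<parallel>u(b) - u(a)\<parallel> \<le> b (j(a) - j(b))\<close> for \<open>a < b\<close>, because \<open>j\<close> turns out to be nonincreasing.
  Conversely stability at \<open>a\<close>, tested with \<open>u(b)\<close>, gives \<open>a (j(a) - j(b)) \<le> \<parallel>u(b) - u(a)\<parallel>\<close>. The two
  bounds agree to first order in \<open>b - a\<close>, so adding them up over fine partitions determines the
  variation and recovers the energy balance. A curve that is stable and satisfies the upper bound
  is called a \<open>stable_descent\<close> below; it makes sense on any set of times.

  Uniqueness. Formally \<open>du = - t p dV\<close> with \<open>p \<in> \<partial>J(u)\<close>, \<open>\<parallel>p\<parallel> \<le> 1/t\<close>, where \<open>dV = - t dj\<close> is the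
  variation measure. For two solutions \<open>u, w\<close> with \<open>q = J(u) - J(w)\<close>, convexity gives
  \<open>d (\<parallel>u - w\<parallel>\<^sup>2 / 2) \<le> t\<^sup>2 d (q\<^sup>2 / 2)\<close>, that is \<open>d ((\<parallel>u - w\<parallel>\<^sup>2 - t\<^sup>2 q\<^sup>2) / 2) \<le> - t q\<^sup>2 dt\<close>. The quantity
  on the left is nonnegative by stability and vanishes at time 0. Hence it vanishes identically,
  so does \<open>q\<close>, and therefore \<open>u = w\<close>. The lemmas \<open>evolution_inequality_step\<close>, \<open>separation_step\<close> and
  \<open>separation_grid\<close> make this rigorous on a grid of times, with an error of the order of the square
  root of the mesh. Jumps need no separate treatment, since the grid version never differentiates.

  Existence. Ekeland's variational principle applied to \<open>J\<close> produces, from a given point, a point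
  that is stable at the next time and satisfies the upper bound exactly, so iterating it yields a
  \<open>stable_descent\<close> on each dyadic grid. Along a subsequence the energies converge at all dyadic
  times, and \<open>separation_grid\<close>, applied to two approximations on a common coarse grid, shows that
  the points then converge too. Left limits extend the limit from the dyadic times to a
  left-continuous curve on the half-line.
\<close>

section \<open>Stable descents and Ekeland's principle\<close>

text \<open>
  The functional is split into its finiteness domain \<open>D\<close> and a real-valued \<open>f\<close> on it, so that the
  estimates below are plain real arithmetic. Lower semicontinuity of the extended functional becomes
  sequential closedness of the sublevel sets, which includes that limits stay in \<open>D\<close>.
\<close>

locale convex_energy =
  fixes D :: "'a::{real_inner, banach} set" and f :: "'a \<Rightarrow> real"
  assumes convex: "convex_on D f"
    and nonneg: "x \<in> D \<Longrightarrow> 0 \<le> f x"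
    and sublevel_closed: "(\<And>n. X n \<in> D \<and> f (X n) \<le> c) \<Longrightarrow> X \<longlonglongrightarrow> x \<Longrightarrow> x \<in> D \<and> f x \<le> c"
begin

definition stable_at :: "real \<Rightarrow> 'a \<Rightarrow> bool" where
  "stable_at t x \<longleftrightarrow> x \<in> D \<and> (\<forall>v\<in>D. t * f x \<le> t * f v + norm (v - x))"

text \<open>
  Stability together with the pairwise form of the upper energy estimate. The time set \<open>Q\<close> is
  arbitrary so that the same notion covers grid approximations, solutions on the open half-line
  (where the energy is known to be finite) and solutions on the closed half-line.
\<close>

definition stable_descent :: "real set \<Rightarrow> (real \<Rightarrow> 'a) \<Rightarrow> bool" where
  "stable_descent Q u \<longleftrightarrow> (\<forall>t\<in>Q. stable_at t (u t)) \<and>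
     (\<forall>a\<in>Q. \<forall>b\<in>Q. a \<le> b \<longrightarrow> norm (u b - u a) \<le> b * (f (u a) - f (u b)))"

lemma stable_descent_mono: "stable_descent Q u \<Longrightarrow> P \<subseteq> Q \<Longrightarrow> stable_descent P u"
  unfolding stable_descent_def by blast

lemma stable_atD: "stable_at t x \<Longrightarrow> v \<in> D \<Longrightarrow> t * f x \<le> t * f v + norm (v - x)"
  by (simp add: stable_at_def)

lemma stable_at_in: "stable_at t x \<Longrightarrow> x \<in> D"
  by (simp add: stable_at_def)

lemma stable_at_0: "x \<in> D \<Longrightarrow> stable_at 0 x"
  by (simp add: stable_at_def)

lemma descent_bound:
  assumes "stable_descent Q u" "a \<in> Q" "b \<in> Q" "a \<le> b"
  shows "norm (u b - u a) \<le> b * (f (u a) - f (u b))"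
  using assms by (auto simp: stable_descent_def)

lemma descent_stable: "stable_descent Q u \<Longrightarrow> t \<in> Q \<Longrightarrow> stable_at t (u t)"
  by (auto simp: stable_descent_def)

lemma descent_in: "stable_descent Q u \<Longrightarrow> t \<in> Q \<Longrightarrow> u t \<in> D"
  by (auto simp: stable_descent_def stable_at_def)

lemma descent_energy_decreasing:
  assumes "stable_descent Q u" "a \<in> Q" "b \<in> Q" "0 \<le> a" "a \<le> b"
  shows "f (u b) \<le> f (u a)"
proof (cases "b = 0")
  case True then show ?thesis using assms by simp
next
  case False
  then have "0 < b" using assms by simp
  moreover have "0 \<le> b * (f (u a) - f (u b))"
    using descent_bound[OF assms(1,2,3,5)] norm_ge_zero order_trans by blast
  ultimately show ?thesis by (simp add: zero_le_mult_iff)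
qed

lemma stable_descent_lower_bound:
  assumes "stable_descent Q u" "a \<in> Q" "b \<in> Q"
  shows "a * (f (u a) - f (u b)) \<le> norm (u b - u a)"
  using stable_atD[OF descent_stable[OF assms(1,2)] descent_in[OF assms(1,3)]]
  by (simp add: algebra_simps)

lemma energy_limit_le:
  assumes X: "\<And>n. X n \<in> D" and lim: "X \<longlonglongrightarrow> x" and l: "(\<lambda>n. f (X n)) \<longlonglongrightarrow> l"
  shows "x \<in> D \<and> f x \<le> l"
proof -
  have *: "x \<in> D \<and> f x \<le> l + e" if "0 < e" for e
  proof -
    have "eventually (\<lambda>n. f (X n) < l + e) sequentially"
      using order_tendstoD(2)[OF l, of "l + e"] that by simp
    then obtain N where N: "\<And>n. n \<ge> N \<Longrightarrow> f (X n) < l + e"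
      by (auto simp: eventually_sequentially)
    have "X (n + N) \<in> D \<and> f (X (n + N)) \<le> l + e" for n
      using X[of "n + N"] N[of "n + N"] by simp
    then show ?thesis
      using sublevel_closed[of "\<lambda>n. X (n + N)"] LIMSEQ_ignore_initial_segment[OF lim] by blast
  qed
  then show ?thesis using zero_less_one field_le_epsilon by blast
qed

text \<open>
  Along stable points the energy is continuous, not merely lower semicontinuous: testing the
  stability of \<open>X n\<close> with the limit \<open>x\<close> bounds \<open>f (X n)\<close> from above. This is what lets the energy
  estimates pass to limits.
\<close>

lemma stable_limit:
  assumes st: "\<And>n. stable_at (t n) (X n)" and t: "t \<longlonglongrightarrow> s" and "0 \<le> s"
    and lim: "X \<longlonglongrightarrow> x" and l: "(\<lambda>n. f (X n)) \<longlonglongrightarrow> l"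
  shows "stable_at s x" and "0 < s \<Longrightarrow> l = f x"
proof -
  have x: "x \<in> D" "f x \<le> l"
    using energy_limit_le[OF stable_at_in[OF st] lim l] by auto
  have *: "s * l \<le> s * f v + norm (v - x)" if "v \<in> D" for v
    by (rule LIMSEQ_le[of "\<lambda>n. t n * f (X n)" _ "\<lambda>n. t n * f v + norm (v - X n)"])
      (use stable_atD[OF st that] in \<open>auto intro!: tendsto_intros t lim l\<close>)
  have "s * f x \<le> s * l" using x \<open>0 \<le> s\<close> by (simp add: mult_left_mono)
  then show "stable_at s x" using * x unfolding stable_at_def by fastforce
  show "l = f x" if "0 < s" using *[OF x(1)] x(2) that by simp
qed

text \<open>
  Increments that are controlled by the loss of a nonnegative energy are summable.
\<close>

lemma Cauchy_by_energy:
  assumes fd: "\<And>m n. m \<le> n \<Longrightarrow> norm (X n - X m) \<le> c * (f (X m) - f (X n))"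
    and X: "\<And>n. X n \<in> D" and c: "0 < c"
  obtains x l where "X \<longlonglongrightarrow> x" "(\<lambda>n. f (X n)) \<longlonglongrightarrow> l" "\<And>n. l \<le> f (X n)"
proof -
  have dec: "decseq (\<lambda>n. f (X n))"
    unfolding decseq_def
  proof (intro allI impI)
    fix m n :: nat assume "m \<le> n"
    then have "0 \<le> c * (f (X m) - f (X n))" using fd norm_ge_zero order_trans by blast
    then show "f (X n) \<le> f (X m)" using c by (simp add: zero_le_mult_iff)
  qed
  obtain l where l: "(\<lambda>n. f (X n)) \<longlonglongrightarrow> l" "\<And>n. l \<le> f (X n)"
    using decseq_convergent[OF dec, of 0] nonneg X by auto
  have "Cauchy X"
  proof (rule metric_CauchyI)
    fix e :: real assume "0 < e"
    then have "eventually (\<lambda>n. f (X n) < l + e / c) sequentially"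
      using order_tendstoD(2)[OF l(1), of "l + e / c"] c by simp
    then obtain N where N: "\<And>n. n \<ge> N \<Longrightarrow> f (X n) < l + e / c"
      by (auto simp: eventually_sequentially)
    have main: "dist (X n) (X m) < e" if "m \<le> n" "N \<le> m" for m n
    proof -
      have "norm (X n - X m) \<le> c * (f (X m) - f (X n))" using fd that by blast
      also have "\<dots> < c * (e / c)"
        using c N[OF that(2)] l(2)[of n] by (intro mult_strict_left_mono) linarith+
      finally show ?thesis using c by (simp add: dist_norm)
    qed
    show "\<exists>M. \<forall>m\<ge>M. \<forall>n\<ge>M. dist (X m) (X n) < e"
    proof (intro exI[of _ N] allI impI)
      fix m n assume "N \<le> m" "N \<le> n"
      then show "dist (X m) (X n) < e"
        using main[of m n] main[of n m] by (cases m n rule: linorder_cases) (auto simp: dist_commute \<open>0 < e\<close>)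
    qed
  qed
  then obtain x where "X \<longlonglongrightarrow> x" using Cauchy_convergent convergent_def by blast
  then show ?thesis using that l by blast
qed

text \<open>
  Ekeland's variational principle, in the form that supplies one time step. The set \<open>S x\<close> of points
  reachable from \<open>x\<close> at an admissible cost shrinks along a sequence that nearly minimises \<open>f\<close> over
  \<open>S (X n)\<close>. A point violating stability of the limit would lie in all these sets with an
  energy below the limit energy.
\<close>

lemma Ekeland:
  assumes x0: "x0 \<in> D" and t: "0 < t"
  obtains x where "stable_at t x" "norm (x - x0) \<le> t * (f x0 - f x)"
proof -
  define S where "S x = {y \<in> D. norm (y - x) \<le> t * (f x - f y)}" for x
  have refl: "x \<in> S x" if "x \<in> D" for x using that by (simp add: S_def)
  have trans: "S y \<subseteq> S x" if "y \<in> S x" for x y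
  proof
    fix z assume "z \<in> S y"
    with that have z: "z \<in> D" "norm (z - y) \<le> t * (f y - f z)" "norm (y - x) \<le> t * (f x - f y)"
      by (auto simp: S_def)
    have "norm (z - x) \<le> norm (z - y) + norm (y - x)"
      using norm_triangle_ineq[of "z - y" "y - x"] by simp
    then show "z \<in> S x" using z by (simp add: S_def algebra_simps)
  qed
  have step: "\<exists>y. y \<in> S x \<and> (\<forall>v\<in>S x. f y \<le> f v + 1 / 2 ^ n)" if "x \<in> D" for x and n :: nat
  proof -
    have bdd: "bdd_below (f ` S x)" by (rule bdd_belowI2[of _ 0]) (auto simp: S_def nonneg)
    have ne: "f ` S x \<noteq> {}" using refl[OF that] by blast
    have "\<exists>y\<in>f ` S x. y < Inf (f ` S x) + 1 / 2 ^ n"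
      using cInf_lessD[OF ne, of "Inf (f ` S x) + 1 / 2 ^ n"] by simp
    then obtain y where "y \<in> S x" "f y < Inf (f ` S x) + 1 / 2 ^ n" by blast
    moreover have "Inf (f ` S x) \<le> f v" if "v \<in> S x" for v
      using cInf_lower[OF _ bdd] that by blast
    ultimately show ?thesis by (intro exI[of _ y]) (smt (verit, best))
  qed
  have "\<exists>X. \<forall>n. (X n \<in> S x0 \<and> (n = 0 \<longrightarrow> X n = x0)) \<and>
      (X (Suc n) \<in> S (X n) \<and> (\<forall>v\<in>S (X n). f (X (Suc n)) \<le> f v + 1 / 2 ^ n))"
  proof (rule dependent_nat_choice)
    show "\<exists>x. x \<in> S x0 \<and> ((0::nat) = 0 \<longrightarrow> x = x0)" using refl[OF x0] by blast
    fix x and n :: nat assume "x \<in> S x0 \<and> (n = 0 \<longrightarrow> x = x0)"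
    then have "x \<in> D" "x \<in> S x0" by (auto simp: S_def)
    then show "\<exists>y. (y \<in> S x0 \<and> (Suc n = 0 \<longrightarrow> y = x0)) \<and> y \<in> S x \<and> (\<forall>v\<in>S x. f y \<le> f v + 1 / 2 ^ n)"
      using step[of x n] trans[of x x0] by auto
  qed
  then obtain X where X0: "X 0 = x0" and XS: "\<And>n. X (Suc n) \<in> S (X n)"
    and Xmin: "\<And>n v. v \<in> S (X n) \<Longrightarrow> f (X (Suc n)) \<le> f v + 1 / 2 ^ n"
    and XD: "\<And>n. X n \<in> D" unfolding S_def by auto
  have mono: "X n \<in> S (X m)" if "m \<le> n" for m n
    using that by (induction n rule: dec_induct) (use refl XD XS trans in blast)+
  obtain x l where lim: "X \<longlonglongrightarrow> x" and l: "(\<lambda>n. f (X n)) \<longlonglongrightarrow> l"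
    using Cauchy_by_energy[of X t] mono XD t unfolding S_def by (smt (verit, best) mem_Collect_eq)
  have x: "x \<in> D" "f x \<le> l" using energy_limit_le[OF XD lim l] by auto
  have inS: "x \<in> S (X m)" for m
  proof -
    have "norm (x - X m) \<le> t * (f (X m) - l)"
      by (rule LIMSEQ_le[of "\<lambda>n. norm (X n - X m)" _ "\<lambda>n. t * (f (X m) - f (X n))"])
        (use mono in \<open>auto intro!: tendsto_intros lim l exI[of _ m] simp: S_def\<close>)
    also have "\<dots> \<le> t * (f (X m) - f x)" using x t by simp
    finally show ?thesis using x by (simp add: S_def)
  qed
  have "t * f x \<le> t * f v + norm (v - x)" if v: "v \<in> D" for v
  proof (rule ccontr)
    assume neg: "\<not> t * f x \<le> t * f v + norm (v - x)"
    then have "v \<in> S x" using v by (simp add: S_def algebra_simps)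
    then have "v \<in> S (X n)" for n using trans[OF inS] by blast
    then have "f (X (Suc n)) \<le> f v + 1 / 2 ^ n" for n using Xmin by blast
    then have "l \<le> f v + 0"
      by (intro LIMSEQ_le[of "\<lambda>n. f (X (Suc n))" _ "\<lambda>n. f v + 1 / 2 ^ n"] tendsto_add
          LIMSEQ_Suc[OF l] tendsto_const LIMSEQ_divide_realpow_zero) auto
    then have "t * f x \<le> t * f v" using x t by simp
    then show False using neg norm_ge_zero[of "v - x"] by linarith
  qed
  then have "stable_at t x" using x by (simp add: stable_at_def)
  then show ?thesis using that inS[of 0] X0 by (auto simp: S_def)
qed

section \<open>Contraction of stable descents\<close>

text \<open>
  A discrete evolution variational inequality: up to an error, \<open>A - B\<close> is \<open>a \<parallel>B - A\<parallel>\<close> times a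
  subgradient of \<open>f\<close> at \<open>B\<close>. Since \<open>A\<close> is stable and \<open>B\<close> nearly realises equality in that stability, \<open>B\<close>
  nearly minimises \<open>v \<mapsto> a f v + \<parallel>v - A\<parallel>\<close>; the inequality is the first variation at \<open>B\<close> towards \<open>z\<close>.
\<close>

lemma evolution_inequality_step:
  assumes A: "stable_at a A" and B: "B \<in> D" and z: "z \<in> D" and ab: "0 \<le> a" "a < b"
    and inc: "norm (B - A) \<le> b * (f A - f B)" and small: "sqrt (b - a) * (f A - f B) \<le> 1"
  shows "inner (B - A) (B - z) \<le> a * norm (B - A) * (f z - f B)
    + sqrt (b - a) * (f A - f B) * (b + (norm (B - z))\<^sup>2 / 2)"
proof -
  define d where "d = f A - f B"
  define h where "h = norm (B - A)"
  define s where "s = sqrt (b - a)"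
  define R where "R = norm (B - z)"
  have s: "0 < s" "s\<^sup>2 = b - a" using ab by (auto simp: s_def)
  have hb: "h \<le> b * d" using inc by (simp add: h_def d_def)
  have h0: "0 \<le> h" by (simp add: h_def)
  have b0: "0 < b" using ab by simp
  have "0 \<le> b * d" using h0 hb by simp
  then have d0: "0 \<le> d" using b0 by (simp add: zero_le_mult_iff)
  have "inner (B - A) (B - z) \<le> a * h * (f z - f B) + s * d * (b + R\<^sup>2 / 2)"
  proof (cases "h = 0")
    case True
    then have "inner (B - A) (B - z) = 0" by (simp add: h_def)
    then show ?thesis using True b0 d0 s by simp
  next
    case False
    then have "0 < h" using h0 by simp
    then have "0 < d" using hb b0 by (smt (verit, best) mult_nonneg_nonpos)
    \<comment> \<open>The step size balances the two errors \<open>h (b - a) d / e\<close> and \<open>e R\<^sup>2 / 2\<close>, making both of order \<open>s d\<close>; the factor \<open>d\<close> keeps their sum over a grid telescoping.\<close>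
    define e where "e = s * d"
    have e: "0 < e" "e \<le> 1" using \<open>0 < d\<close> s small by (auto simp: e_def s_def d_def)
    define v where "v = (1 - e) *\<^sub>R B + e *\<^sub>R z"
    have vD: "v \<in> D" and fv: "f v \<le> (1 - e) * f B + e * f z"
      using convex_onD[OF convex, of e B z] e B z convex_on_imp_convex[OF convex]
      by (auto simp: v_def convex_alt)
    have nv: "(norm (v - A))\<^sup>2 = h\<^sup>2 + 2 * e * inner (B - A) (z - B) + e\<^sup>2 * R\<^sup>2"
    proof -
      have "v - A = (B - A) + e *\<^sub>R (z - B)" by (simp add: v_def algebra_simps)
      show ?thesis unfolding \<open>v - A = _\<close> h_def R_def power2_norm_eq_inner
        by (simp add: inner_add_left inner_add_right inner_commute inner_diff_left inner_diff_right power2_eq_square algebra_simps)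
    qed
    \<comment> \<open>The norm is linearised around \<open>h > 0\<close> by the arithmetic-geometric mean inequality.\<close>
    have "2 * h * norm (v - A) \<le> (norm (v - A))\<^sup>2 + h\<^sup>2"
      using zero_le_power2[of "norm (v - A) - h"] by (simp add: power2_diff algebra_simps)
    then have n: "2 * h * norm (v - A) \<le> 2 * h\<^sup>2 + 2 * e * inner (B - A) (z - B) + e\<^sup>2 * R\<^sup>2"
      using nv by simp
    have "b * f B + h \<le> b * f A" using hb by (simp add: d_def algebra_simps)
    also have "\<dots> \<le> a * f v + norm (v - A) + (b - a) * f A"
      using stable_atD[OF A vD] by (simp add: algebra_simps)
    finally have "b * f B + h \<le> a * f v + norm (v - A) + (b - a) * f A" .
    moreover have "a * f v \<le> a * ((1 - e) * f B + e * f z)"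
      using fv ab by (simp add: mult_left_mono)
    ultimately have "h \<le> (b - a) * d + a * e * (f z - f B) + norm (v - A)"
      by (simp add: algebra_simps d_def)
    then have "2 * h * h \<le> 2 * h * ((b - a) * d + a * e * (f z - f B) + norm (v - A))"
      using \<open>0 < h\<close> by (intro mult_left_mono) auto
    then have "2 * h * h \<le> 2 * h * (b - a) * d + 2 * h * a * e * (f z - f B)
        + (2 * h\<^sup>2 + 2 * e * inner (B - A) (z - B) + e\<^sup>2 * R\<^sup>2)"
      using n by (simp add: algebra_simps)
    moreover have "h * (b - a) * d = e * (h * s)"
      using s by (simp add: e_def power2_eq_square)
    moreover have "inner (B - A) (z - B) = - inner (B - A) (B - z)"
      by (simp add: inner_diff_right)
    ultimately have "e * (2 * inner (B - A) (B - z)) \<le> e * (2 * (h * s) + 2 * h * a * (f z - f B) + e * R\<^sup>2)"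
      by (simp add: algebra_simps power2_eq_square)
    then have "2 * inner (B - A) (B - z) \<le> 2 * (h * s) + 2 * h * a * (f z - f B) + e * R\<^sup>2"
      using e by simp
    moreover have "h * s \<le> b * d * s" using hb s by (simp add: mult_right_mono)
    ultimately show ?thesis by (simp add: e_def algebra_simps)
  qed
  then show ?thesis by (simp add: d_def h_def s_def R_def)
qed

text \<open>
  The Lyapunov functional for pairs of solutions. Stability of two points at time \<open>t\<close> says exactly
  that their energies differ by at most \<open>\<parallel>x - y\<parallel> / t\<close>, which makes this nonnegative.
\<close>

definition separation :: "real \<Rightarrow> 'a \<Rightarrow> 'a \<Rightarrow> real" where
  "separation t x y = ((norm (x - y))\<^sup>2 - (t * (f x - f y))\<^sup>2) / 2"

lemma separation_nonneg:
  assumes "0 \<le> t" "stable_at t x" "stable_at t y"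
  shows "0 \<le> separation t x y"
proof -
  have "t * (f x - f y) \<le> norm (x - y)" "t * (f y - f x) \<le> norm (x - y)"
    using stable_atD[OF assms(2) stable_at_in[OF assms(3)]]
      stable_atD[OF assms(3) stable_at_in[OF assms(2)]]
    by (simp_all add: algebra_simps norm_minus_commute)
  then have "\<bar>t * (f x - f y)\<bar> \<le> norm (x - y)" by (simp add: abs_le_iff right_diff_distrib)
  then have "(t * (f x - f y))\<^sup>2 \<le> (norm (x - y))\<^sup>2"
    using abs_le_square_iff by fastforce
  then show ?thesis by (simp add: separation_def)
qed

text \<open>
  Adding the evolution inequalities of the two curves, each tested with the other, bounds the change
  of \<open>\<parallel>u - w\<parallel>\<^sup>2 / 2\<close> by \<open>- a (h - h') p - (h - h')\<^sup>2 / 2\<close>, where \<open>h, h'\<close> are the step lengths and \<open>p\<close> is the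
  new energy difference. The quadratic term comes from the squared difference of the two steps and
  has to be kept: \<open>h - h'\<close> is close to \<open>a (q - p)\<close>, and then completing the square gives
  \<open>a\<^sup>2 (p\<^sup>2 - q\<^sup>2) / 2\<close> even when the energies jump.
\<close>

lemma separation_step:
  assumes A: "stable_at a A" "stable_at a A'" and B: "B \<in> D" "B' \<in> D"
    and ab: "0 \<le> a" "a < b" "b \<le> T" "b - a \<le> 1"
    and inc: "norm (B - A) \<le> b * (f A - f B)" "norm (B' - A') \<le> b * (f A' - f B')"
    and fM: "f A \<le> M" "f A' \<le> M" and small: "sqrt (b - a) * M \<le> 1"
    and R: "norm (B - B') \<le> R"
  shows "separation b B B' + (b\<^sup>2 - a\<^sup>2) * (f B - f B')\<^sup>2 / 2 \<le> separation a A A'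
    + sqrt (b - a) * (T + R\<^sup>2 / 2 + T * M) * ((f A - f B) + (f A' - f B'))"
proof -
  define s where "s = sqrt (b - a)"
  define d where "d = f A - f B"
  define d' where "d' = f A' - f B'"
  define q where "q = f A - f A'"
  define p where "p = f B - f B'"
  define h where "h = norm (B - A)"
  define h' where "h' = norm (B' - A')"
  define e where "e = (h - h') - a * (d - d')"
  have s: "0 < s" "s \<le> 1" "s\<^sup>2 = b - a" using ab by (auto simp: s_def)
  have b0: "0 < b" using ab by simp
  have "0 \<le> b * d" "0 \<le> b * d'"
    using inc norm_ge_zero order_trans unfolding d_def d'_def by blast+
  then have d0: "0 \<le> d" "0 \<le> d'" using b0 by (auto simp: zero_le_mult_iff)
  have AD: "A \<in> D" "A' \<in> D" using A stable_at_in by auto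
  have pos: "0 \<le> f A" "0 \<le> f A'" "0 \<le> f B" "0 \<le> f B'" using AD B nonneg by auto
  have dM: "d \<le> M" "d' \<le> M" using pos fM by (auto simp: d_def d'_def)
  have sd: "s * d \<le> 1" "s * d' \<le> 1"
    using mult_left_mono[OF dM(1), of s] mult_left_mono[OF dM(2), of s] s(1) small[folded s_def]
    by linarith+
  have RR: "(norm (B - B'))\<^sup>2 \<le> R\<^sup>2" using R by (simp add: power_mono)
  have err: "s * d * (b + (norm (B - B'))\<^sup>2 / 2) \<le> s * d * (T + R\<^sup>2 / 2)" if "0 \<le> d" for d
    using RR ab that s by (intro mult_left_mono) auto
  have "inner (B - A) (B - B') \<le> a * h * (f B' - f B) + s * d * (T + R\<^sup>2 / 2)"
    using evolution_inequality_step[OF A(1) B ab(1,2) inc(1)] sd err[OF d0(1)]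
    by (simp add: s_def d_def h_def)
  moreover have "inner (B' - A') (B' - B) \<le> a * h' * (f B - f B') + s * d' * (T + R\<^sup>2 / 2)"
    using evolution_inequality_step[OF A(2) B(2,1) ab(1,2) inc(2)] sd err[OF d0(2)]
    by (simp add: s_def d'_def h'_def norm_minus_commute)
  moreover have "(norm (B - B'))\<^sup>2 - (norm (A - A'))\<^sup>2 =
      2 * inner (B - A) (B - B') + 2 * inner (B' - A') (B' - B) - (norm ((B - A) - (B' - A')))\<^sup>2"
    unfolding power2_norm_eq_inner
    by (simp add: inner_add_left inner_add_right inner_commute inner_diff_left inner_diff_right algebra_simps)
  moreover have "(h - h')\<^sup>2 \<le> (norm ((B - A) - (B' - A')))\<^sup>2"
    unfolding h_def h'_def using norm_triangle_ineq3[of "B - A" "B' - A'"]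
    by (metis abs_le_square_iff abs_norm_cancel)
  ultimately have main: "(norm (B - B'))\<^sup>2 - (norm (A - A'))\<^sup>2 \<le>
      - 2 * a * (h - h') * p - (h - h')\<^sup>2 + 2 * s * (d + d') * (T + R\<^sup>2 / 2)"
    by (simp add: p_def algebra_simps)
  have hh: "h - h' = a * (q - p) + e" by (simp add: e_def q_def p_def d_def d'_def)
  have "- 2 * a * (h - h') * p - (h - h')\<^sup>2 = a\<^sup>2 * p\<^sup>2 - a\<^sup>2 * q\<^sup>2 - 2 * a * q * e - e\<^sup>2"
    unfolding hh by (simp add: power2_eq_square algebra_simps)
  also have "\<dots> \<le> a\<^sup>2 * p\<^sup>2 - a\<^sup>2 * q\<^sup>2 + 2 * (T * M * (s * (d + d')))"
  proof -
    have lo: "a * d \<le> h" "a * d' \<le> h'"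
      using stable_atD[OF A(1) B(1)] stable_atD[OF A(2) B(2)]
      by (simp_all add: d_def d'_def h_def h'_def algebra_simps)
    have hi: "h \<le> b * d" "h' \<le> b * d'" using inc by (simp_all add: d_def d'_def h_def h'_def)
    have "\<bar>e\<bar> \<le> (b - a) * (d + d')"
      using lo hi mult_left_mono[OF d0(1), of "b - a"] mult_left_mono[OF d0(2), of "b - a"] ab
      by (auto simp: e_def abs_le_iff algebra_simps)
    also have "\<dots> \<le> s * (d + d')"
      using s d0 by (intro mult_right_mono) (auto simp: power2_eq_square simp flip: s(3))
    finally have e: "\<bar>e\<bar> \<le> s * (d + d')" .
    have "\<bar>q\<bar> \<le> M" using pos fM by (auto simp: q_def)
    then have "a * \<bar>q\<bar> \<le> T * M" using ab by (intro mult_mono) auto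
    then have "(a * \<bar>q\<bar>) * \<bar>e\<bar> \<le> (T * M) * (s * (d + d'))"
      by (rule mult_mono[OF _ e]) (use \<open>a * \<bar>q\<bar> \<le> T * M\<close> ab order_trans[of 0 "a * \<bar>q\<bar>" "T * M"] in auto)
    moreover have "- (a * q * e) \<le> (a * \<bar>q\<bar>) * \<bar>e\<bar>"
      using ab by (metis abs_ge_minus_self abs_mult abs_of_nonneg)
    ultimately show ?thesis using zero_le_power2[of e] by (simp add: algebra_simps)
  qed
  finally have "- 2 * a * (h - h') * p - (h - h')\<^sup>2 \<le>
    a\<^sup>2 * p\<^sup>2 - a\<^sup>2 * q\<^sup>2 + 2 * (T * M * (s * (d + d')))" .
  moreover have "s * (T + R\<^sup>2 / 2 + T * M) * (d + d') =
      s * (d + d') * (T + R\<^sup>2 / 2) + T * M * (s * (d + d'))"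
    by (simp only: distrib_left distrib_right mult.assoc mult.commute mult.left_commute add.assoc add.commute add.left_commute)
  ultimately have "(norm (B - B'))\<^sup>2 - (norm (A - A'))\<^sup>2 \<le>
    a\<^sup>2 * p\<^sup>2 - a\<^sup>2 * q\<^sup>2 + 2 * (s * (T + R\<^sup>2 / 2 + T * M) * (d + d'))"
    using main by linarith
  then show ?thesis
    unfolding separation_def s_def[symmetric] d_def[symmetric] d'_def[symmetric]
      p_def[symmetric] q_def[symmetric]
    by (simp add: power_mult_distrib field_simps)
qed

text \<open>
  The errors of the single steps add up to a multiple of \<open>sqrt \<delta>\<close>, because the energy losses
  telescope. The lower bound \<open>\<kappa>\<close> on the squared energy difference is the discrete form of the
  dissipation term \<open>t q\<^sup>2\<close>: it is 0 where only monotonicity matters, and positive on a short interval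
  where a nonzero energy difference is to be excluded.
\<close>

lemma separation_grid:
  fixes \<delta> :: real
  assumes u: "stable_descent Q u" and w: "stable_descent Q w"
    and Q: "\<And>i. i \<le> N \<Longrightarrow> r + real i * \<delta> \<in> Q"
    and r: "0 \<le> r" and \<delta>: "0 < \<delta>" "\<delta> \<le> 1"
    and T: "r + real N * \<delta> \<le> T"
    and M: "f (u r) \<le> M" "f (w r) \<le> M" "sqrt \<delta> * M \<le> 1"
    and R: "2 * T * M + norm (u r - w r) \<le> R"
    and \<kappa>: "\<And>i. 1 \<le> i \<Longrightarrow> i \<le> N \<Longrightarrow>
      \<kappa> \<le> (f (u (r + real i * \<delta>)) - f (w (r + real i * \<delta>)))\<^sup>2"
  shows "separation (r + real N * \<delta>) (u (r + real N * \<delta>)) (w (r + real N * \<delta>))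
      + \<kappa> / 2 * ((r + real N * \<delta>)\<^sup>2 - r\<^sup>2)
    \<le> separation r (u r) (w r) + 2 * sqrt \<delta> * (T + R\<^sup>2 / 2 + T * M) * M"
proof -
  define g where "g i = r + real i * \<delta>" for i :: nat
  define C where "C = T + R\<^sup>2 / 2 + T * M"
  have gQ: "g i \<in> Q" if "i \<le> N" for i using Q[OF that] by (simp add: g_def)
  have g0: "0 \<le> g i" "r \<le> g i" for i using r \<delta> by (auto simp: g_def)
  have gT: "g i \<le> T" if "i \<le> N" for i
  proof -
    have "real i * \<delta> \<le> real N * \<delta>" using that \<delta> by simp
    then show ?thesis using T by (simp add: g_def)
  qed
  have r': "r = g 0" by (simp add: g_def)
  have rQ: "r \<in> Q" using gQ[of 0] r' by simp
  have T0: "0 \<le> T" using gT[of 0] g0[of 0] by simp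
  have pos: "0 \<le> f (u (g i))" "0 \<le> f (w (g i))" if "i \<le> N" for i
    using nonneg descent_in[OF u gQ[OF that]] descent_in[OF w gQ[OF that]] by auto
  have dec: "f (u (g i)) \<le> M" "f (w (g i)) \<le> M" if "i \<le> N" for i
    using descent_energy_decreasing[OF u rQ gQ[OF that] r g0(2)] M
      descent_energy_decreasing[OF w rQ gQ[OF that] r g0(2)] by auto
  have M0: "0 \<le> M" using dec(1)[of 0] pos(1)[of 0] by simp
  have C0: "0 \<le> C" using T0 M0 by (simp add: C_def)
  have dist_uw: "norm (u (g i) - w (g i)) \<le> R" if i: "i \<le> N" for i
  proof -
    have far: "norm (x (g i) - x r) \<le> T * M" if x: "stable_descent Q x" "f (x r) \<le> M" for x
    proof -
      have "norm (x (g i) - x r) \<le> g i * (f (x r) - f (x (g i)))"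
        using descent_bound[OF x(1) rQ gQ[OF i] g0(2)] .
      also have "\<dots> \<le> T * M"
        using x(2) nonneg[OF descent_in[OF x(1) gQ[OF i]]] gT[OF i] g0 T0
          descent_energy_decreasing[OF x(1) rQ gQ[OF i] r g0(2)]
        by (intro mult_mono) auto
      finally show ?thesis .
    qed
    have "u (g i) - w (g i) = (u (g i) - u r) + (u r - w r) + (w r - w (g i))" by simp
    then have "norm (u (g i) - w (g i)) \<le> norm (u (g i) - u r) + norm (u r - w r) + norm (w r - w (g i))"
      by (metis add_mono_thms_linordered_semiring(3) norm_triangle_ineq norm_triangle_mono order_refl)
    then show ?thesis using far[OF u M(1)] far[OF w M(2)] R by (simp add: norm_minus_commute)
  qed
  have "separation (g i) (u (g i)) (w (g i)) + \<kappa> / 2 * ((g i)\<^sup>2 - r\<^sup>2)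
    \<le> separation r (u r) (w r) + sqrt \<delta> * C * (f (u r) - f (u (g i)) + (f (w r) - f (w (g i))))"
    if "i \<le> N" for i
    using that
  proof (induction i)
    case 0
    then show ?case by (simp add: g_def)
  next
    case (Suc i)
    then have i: "i \<le> N" by simp
    have gs: "g (Suc i) = g i + \<delta>" by (simp add: g_def algebra_simps)
    have sq: "(g i)\<^sup>2 \<le> (g (Suc i))\<^sup>2" using g0 \<delta> gs by (simp add: power_mono)
    have one: "separation (g (Suc i)) (u (g (Suc i))) (w (g (Suc i)))
        + ((g (Suc i))\<^sup>2 - (g i)\<^sup>2) * (f (u (g (Suc i))) - f (w (g (Suc i))))\<^sup>2 / 2
      \<le> separation (g i) (u (g i)) (w (g i)) + sqrt (g (Suc i) - g i) * C *
        ((f (u (g i)) - f (u (g (Suc i)))) + (f (w (g i)) - f (w (g (Suc i)))))"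
      unfolding C_def
      using descent_stable[OF u gQ[OF i]] descent_stable[OF w gQ[OF i]]
        descent_in[OF u gQ[OF Suc.prems]] descent_in[OF w gQ[OF Suc.prems]]
        descent_bound[OF u gQ[OF i] gQ[OF Suc.prems]] descent_bound[OF w gQ[OF i] gQ[OF Suc.prems]]
        dec[OF i] dist_uw[OF Suc.prems] gT[OF Suc.prems] g0(1)[of i] \<delta> gs M(3)
      by (intro separation_step) auto
    have dd: "g (Suc i) - g i = \<delta>" by (simp add: gs)
    note one[unfolded dd]
    moreover have "((g (Suc i))\<^sup>2 - (g i)\<^sup>2) * \<kappa>
        \<le> ((g (Suc i))\<^sup>2 - (g i)\<^sup>2) * (f (u (g (Suc i))) - f (w (g (Suc i))))\<^sup>2"
      using \<kappa>[of "Suc i"] Suc.prems sq unfolding g_def by (intro mult_left_mono) auto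
    moreover have "\<kappa> / 2 * ((g (Suc i))\<^sup>2 - r\<^sup>2) =
        \<kappa> / 2 * ((g i)\<^sup>2 - r\<^sup>2) + ((g (Suc i))\<^sup>2 - (g i)\<^sup>2) * \<kappa> / 2"
      by (simp add: algebra_simps diff_divide_distrib)
    moreover have "sqrt \<delta> * C * (f (u r) - f (u (g (Suc i))) + (f (w r) - f (w (g (Suc i))))) =
        sqrt \<delta> * C * (f (u r) - f (u (g i)) + (f (w r) - f (w (g i)))) +
        sqrt \<delta> * C * ((f (u (g i)) - f (u (g (Suc i)))) + (f (w (g i)) - f (w (g (Suc i)))))"
      by (simp only: distrib_left[symmetric]) simp
    ultimately show ?case using Suc.IH[OF i] by linarith
  qed
  from this[OF order_refl] have "separation (g N) (u (g N)) (w (g N)) + \<kappa> / 2 * ((g N)\<^sup>2 - r\<^sup>2)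
    \<le> separation r (u r) (w r) + sqrt \<delta> * C * (f (u r) - f (u (g N)) + (f (w r) - f (w (g N))))" .
  moreover have "sqrt \<delta> * C * (f (u r) - f (u (g N)) + (f (w r) - f (w (g N)))) \<le> sqrt \<delta> * C * (2 * M)"
    using M pos[of N] C0 \<delta> by (intro mult_left_mono) auto
  moreover have "sqrt \<delta> * C * (2 * M) = 2 * sqrt \<delta> * C * M" by simp
  ultimately have "separation (g N) (u (g N)) (w (g N)) + \<kappa> / 2 * ((g N)\<^sup>2 - r\<^sup>2)
    \<le> separation r (u r) (w r) + 2 * sqrt \<delta> * C * M" by linarith
  then show ?thesis by (simp only: g_def C_def)
qed

section \<open>Uniqueness of left-continuous stable descents\<close>

text \<open>
  The limit of \<open>separation_grid\<close> over uniform partitions of \<open>[r, T]\<close>.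
\<close>

lemma separation_decreasing:
  assumes u: "stable_descent {0<..} u" and w: "stable_descent {0<..} w" and r: "0 < r" "r < T"
    and \<kappa>: "\<And>t. r < t \<Longrightarrow> t \<le> T \<Longrightarrow> \<kappa> \<le> (f (u t) - f (w t))\<^sup>2"
  shows "separation T (u T) (w T) + \<kappa> / 2 * (T\<^sup>2 - r\<^sup>2) \<le> separation r (u r) (w r)"
proof -
  define M where "M = max (f (u r)) (f (w r))"
  define R where "R = 2 * T * M + norm (u r - w r)"
  define \<delta> where "\<delta> N = (T - r) / real N" for N
  have \<delta>0: "\<delta> \<longlonglongrightarrow> 0" unfolding \<delta>_def by (rule lim_const_over_n)
  then have s0: "(\<lambda>N. sqrt (\<delta> N)) \<longlonglongrightarrow> 0" using tendsto_real_sqrt by fastforce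
  then have "(\<lambda>N. sqrt (\<delta> N) * M) \<longlonglongrightarrow> 0" by (rule tendsto_mult_left_zero)
  then have ev: "eventually (\<lambda>N. \<delta> N < 1 \<and> sqrt (\<delta> N) * M < 1 \<and> 0 < N) sequentially"
    using \<delta>0 by (intro eventually_conj order_tendstoD(2) eventually_gt_at_top) auto
  have "eventually (\<lambda>N. separation T (u T) (w T) + \<kappa> / 2 * (T\<^sup>2 - r\<^sup>2)
    \<le> separation r (u r) (w r) + 2 * sqrt (\<delta> N) * (T + R\<^sup>2 / 2 + T * M) * M) sequentially"
    using ev
  proof eventually_elim
    case (elim N)
    have T: "r + real N * \<delta> N = T" using elim by (simp add: \<delta>_def)
    have pos: "0 < \<delta> N" using elim r by (simp add: \<delta>_def)
    have le: "r + real i * \<delta> N \<le> T" if "i \<le> N" for i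
    proof -
      have "real i * \<delta> N \<le> real N * \<delta> N" using that pos by (intro mult_right_mono) auto
      then show ?thesis using T by linarith
    qed
    have "0 < r + real i * \<delta> N" for i
      using r pos by (simp add: add_pos_nonneg)
    then show ?case
      using separation_grid[OF u w, of N r "\<delta> N" T M R \<kappa>] pos elim r T le \<kappa>
      by (auto simp: M_def R_def)
  qed
  moreover have "(\<lambda>N. separation r (u r) (w r) + 2 * sqrt (\<delta> N) * (T + R\<^sup>2 / 2 + T * M) * M)
      \<longlonglongrightarrow> separation r (u r) (w r) + 2 * 0 * (T + R\<^sup>2 / 2 + T * M) * M"
    by (intro tendsto_intros s0)
  ultimately show ?thesis by (intro tendsto_lowerbound[of _ _ sequentially]) auto
qed

text \<open>
  Stability at \<open>s\<close>, tested with \<open>u t\<close>, bounds \<open>f (u s)\<close> from above as \<open>s\<close> increases to \<open>t\<close>;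
  monotonicity bounds it from below.
\<close>

lemma energy_left_continuous:
  assumes u: "stable_descent {0<..} u" and t: "0 < t" and lim: "(u \<longlongrightarrow> u t) (at_left t)"
  shows "((\<lambda>s. f (u s)) \<longlongrightarrow> f (u t)) (at_left t)"
proof -
  have ev: "eventually (\<lambda>s. t / 2 < s \<and> s < t) (at_left t)"
    using eventually_at_left_real[of "t / 2" t] t by auto
  show ?thesis
  proof (rule tendsto_sandwich[of "\<lambda>_. f (u t)" _ _ "\<lambda>s. f (u t) + norm (u t - u s) / (t / 2)"])
    show "eventually (\<lambda>s. f (u t) \<le> f (u s)) (at_left t)"
      using ev by eventually_elim (use descent_energy_decreasing[OF u] t in auto)
    show "eventually (\<lambda>s. f (u s) \<le> f (u t) + norm (u t - u s) / (t / 2)) (at_left t)"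
      using ev
    proof eventually_elim
      case (elim s)
      then have "s * (f (u s) - f (u t)) \<le> norm (u t - u s)"
        using stable_descent_lower_bound[OF u, of s t] t by auto
      moreover have "0 \<le> f (u s) - f (u t)"
        using descent_energy_decreasing[OF u, of s t] elim t by auto
      ultimately have "t / 2 * (f (u s) - f (u t)) \<le> norm (u t - u s)"
        using elim mult_right_mono[of "t / 2" s "f (u s) - f (u t)"] by simp
      then show ?case using t by (simp add: field_simps)
    qed
    have "((\<lambda>s. f (u t) + norm (u t - u s) / (t / 2)) \<longlongrightarrow> f (u t) + norm (u t - u t) / (t / 2)) (at_left t)"
      by (intro tendsto_intros lim) (use t in auto)
    then show "((\<lambda>s. f (u t) + norm (u t - u s) / (t / 2)) \<longlongrightarrow> f (u t)) (at_left t)" by simp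
  qed simp
qed

text \<open>
  The separation is nonincreasing, nonnegative and tends to 0 at time 0, so it vanishes. A nonzero
  energy difference at \<open>T\<close> would persist on an interval to the left of \<open>T\<close> by left-continuity, and
  there \<open>separation_decreasing\<close> would force a strict decrease.
\<close>

lemma stable_descent_unique:
  assumes u: "stable_descent {0<..} u" and w: "stable_descent {0<..} w"
    and init: "((\<lambda>t. u t - w t) \<longlongrightarrow> 0) (at_right 0)"
    and lu: "\<And>t. 0 < t \<Longrightarrow> (u \<longlongrightarrow> u t) (at_left t)"
    and lw: "\<And>t. 0 < t \<Longrightarrow> (w \<longlongrightarrow> w t) (at_left t)"
    and T: "0 < T"
  shows "u T = w T"
proof -
  have zero: "separation t (u t) (w t) = 0" if t: "0 < t" for t
  proof (rule antisym)
    have "((\<lambda>r. (norm (u r - w r))\<^sup>2 / 2) \<longlongrightarrow> (norm (0::'a))\<^sup>2 / 2) (at_right 0)"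
      by (intro tendsto_intros init) auto
    moreover have "eventually (\<lambda>r. separation t (u t) (w t) \<le> (norm (u r - w r))\<^sup>2 / 2) (at_right 0)"
      using eventually_at_right_real[OF t]
    proof eventually_elim
      case (elim r)
      then have "separation t (u t) (w t) \<le> separation r (u r) (w r)"
        using separation_decreasing[OF u w, of r t 0] by auto
      also have "\<dots> \<le> (norm (u r - w r))\<^sup>2 / 2" by (simp add: separation_def)
      finally show ?case .
    qed
    ultimately show "separation t (u t) (w t) \<le> 0"
      using tendsto_lowerbound[of _ _ "at_right (0::real)"] by fastforce
    show "0 \<le> separation t (u t) (w t)"
      using separation_nonneg[of t "u t" "w t"] descent_stable[OF u] descent_stable[OF w] t by auto
  qed
  define q where "q t = f (u t) - f (w t)" for t
  have "q T = 0"
  proof (rule ccontr)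
    assume ne: "q T \<noteq> 0"
    have "((\<lambda>s. (q s)\<^sup>2) \<longlongrightarrow> (q T)\<^sup>2) (at_left T)"
      unfolding q_def
      by (intro tendsto_intros energy_left_continuous[OF u T lu[OF T]] energy_left_continuous[OF w T lw[OF T]])
    moreover have "(q T)\<^sup>2 / 2 < (q T)\<^sup>2" using ne by simp
    ultimately have "eventually (\<lambda>s. (q T)\<^sup>2 / 2 < (q s)\<^sup>2) (at_left T)"
      using order_tendstoD(1) by blast
    then obtain b where b: "b < T" "\<And>s. b < s \<Longrightarrow> s < T \<Longrightarrow> (q T)\<^sup>2 / 2 < (q s)\<^sup>2"
      by (auto simp: eventually_at_left_field)
    define r where "r = max b (T / 2)"
    have r: "0 < r" "r < T" using b T by (auto simp: r_def)
    have "(q T)\<^sup>2 / 2 \<le> (q s)\<^sup>2" if "r < s" "s \<le> T" for s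
      using b(2)[of s] that by (cases "s = T") (auto simp: r_def)
    then have "separation T (u T) (w T) + (q T)\<^sup>2 / 2 / 2 * (T\<^sup>2 - r\<^sup>2) \<le> separation r (u r) (w r)"
      using separation_decreasing[OF u w r, of "(q T)\<^sup>2 / 2"] by (simp add: q_def)
    then have "(q T)\<^sup>2 * (T\<^sup>2 - r\<^sup>2) \<le> 0" using zero r T by simp
    moreover have "r\<^sup>2 < T\<^sup>2" using r by (simp add: power_strict_mono)
    ultimately show False using ne by (simp add: mult_le_0_iff)
  qed
  then have "(norm (u T - w T))\<^sup>2 = 0"
    using zero[OF T] by (simp add: separation_def q_def)
  then show ?thesis by simp
qed

section \<open>Construction of a left-continuous stable descent\<close>

text \<open>
  Ekeland's principle applied successively at the times \<open>\<delta>, 2 \<delta>, \<dots>\<close>. Each step satisfies the upper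
  energy estimate exactly, and since the times increase the estimates of consecutive steps add up to
  the one for the pair. Extending \<open>u\<close> off the grid by the value at the nearest grid time provides
  energy bounds at all times at once.
\<close>

lemma grid_descent:
  assumes x0: "x0 \<in> D" and \<delta>: "0 < \<delta>"
  obtains u where "stable_descent (range (\<lambda>k::nat. real k * \<delta>)) u" "u 0 = x0"
    "\<And>t. u t \<in> D" "\<And>t. f (u t) \<le> f x0"
proof -
  have "\<exists>X. \<forall>k. (stable_at (real k * \<delta>) (X k) \<and> (k = 0 \<longrightarrow> X k = x0)) \<and>
      norm (X (Suc k) - X k) \<le> real (Suc k) * \<delta> * (f (X k) - f (X (Suc k)))"
  proof (rule dependent_nat_choice)
    show "\<exists>x. stable_at (real 0 * \<delta>) x \<and> ((0::nat) = 0 \<longrightarrow> x = x0)"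
      using stable_at_0[OF x0] by auto
    fix x and k :: nat assume "stable_at (real k * \<delta>) x \<and> (k = 0 \<longrightarrow> x = x0)"
    then have "x \<in> D" using stable_at_in by blast
    then obtain y where "stable_at (real (Suc k) * \<delta>) y" "norm (y - x) \<le> real (Suc k) * \<delta> * (f x - f y)"
      using Ekeland[of x "real (Suc k) * \<delta>"] \<delta> by (metis mult_pos_pos of_nat_0_less_iff zero_less_Suc)
    then show "\<exists>y. (stable_at (real (Suc k) * \<delta>) y \<and> (Suc k = 0 \<longrightarrow> y = x0)) \<and>
        norm (y - x) \<le> real (Suc k) * \<delta> * (f x - f y)" by auto
  qed
  then obtain X where st: "\<And>k. stable_at (real k * \<delta>) (X k)" and X0: "X 0 = x0"
    and step: "\<And>k. norm (X (Suc k) - X k) \<le> real (Suc k) * \<delta> * (f (X k) - f (X (Suc k)))"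
    by blast
  have XD: "X k \<in> D" for k using st stable_at_in by blast
  have "decseq (\<lambda>k. f (X k))"
  proof (rule decseq_SucI)
    fix k
    have "0 \<le> real (Suc k) * \<delta> * (f (X k) - f (X (Suc k)))"
      using step norm_ge_zero order_trans by blast
    moreover have "0 < real (Suc k) * \<delta>" using \<delta> by simp
    ultimately show "f (X (Suc k)) \<le> f (X k)" by (metis diff_ge_0_iff_ge zero_le_mult_iff not_le)
  qed
  then have dec: "f (X j) \<le> f (X i)" if "i \<le> j" for i j using that by (simp add: decseq_def)
  have bound: "norm (X j - X i) \<le> real j * \<delta> * (f (X i) - f (X j))" if "i \<le> j" for i j
    using that
  proof (induction j rule: dec_induct)
    case base then show ?case by simp
  next
    case (step n)
    have "norm (X (Suc n) - X i) \<le> norm (X (Suc n) - X n) + norm (X n - X i)"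
      using norm_triangle_ineq[of "X (Suc n) - X n" "X n - X i"] by simp
    also have "\<dots> \<le> real (Suc n) * \<delta> * (f (X n) - f (X (Suc n))) + real n * \<delta> * (f (X i) - f (X n))"
      using \<open>\<And>k. norm (X (Suc k) - X k) \<le> _\<close> step.IH by (intro add_mono)
    also have "real n * \<delta> * (f (X i) - f (X n)) \<le> real (Suc n) * \<delta> * (f (X i) - f (X n))"
      using \<delta> dec[OF step.hyps(1)] by (intro mult_right_mono) auto
    finally show ?case by (simp add: algebra_simps)
  qed
  \<comment> \<open>Rounding is exact on the grid and maps negative times to index 0.\<close>
  define u where "u t = X (nat (round (t / \<delta>)))" for t
  have uX: "u (real k * \<delta>) = X k" for k using \<delta> by (simp add: u_def)
  have "stable_descent (range (\<lambda>k::nat. real k * \<delta>)) u"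
    unfolding stable_descent_def using st bound \<delta> by (auto simp: uX)
  moreover have "u 0 = x0" using uX[of 0] X0 by simp
  moreover have "u t \<in> D" "f (u t) \<le> f x0" for t using XD dec[of 0] X0 by (auto simp: u_def)
  ultimately show ?thesis using that by blast
qed

definition dyadic :: "nat \<Rightarrow> real set" where
  "dyadic n = range (\<lambda>k::nat. real k * (1 / 2 ^ n))"

lemma dyadic_mono: "m \<le> n \<Longrightarrow> dyadic m \<subseteq> dyadic n"
proof
  fix t assume "m \<le> n" "t \<in> dyadic m"
  then obtain k where "t = real k * (1 / 2 ^ m)" by (auto simp: dyadic_def)
  then have "t = real (k * 2 ^ (n - m)) * (1 / 2 ^ n)"
    using \<open>m \<le> n\<close> power_add[of "2::real" m "n - m"] by (simp add: field_simps)
  then show "t \<in> dyadic n" unfolding dyadic_def by blast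
qed

lemma zero_dyadic: "0 \<in> dyadic n"
  unfolding dyadic_def by (rule range_eqI[of _ _ 0]) simp

lemma dyadic_nonneg: "t \<in> dyadic n \<Longrightarrow> 0 \<le> t"
  unfolding dyadic_def by auto

text \<open>
  Grid approximations of mesh \<open>1 / 2 ^ p\<close> or finer are stable descents on the grid of mesh \<open>1 / 2 ^ p\<close>
  and start at the same point, so by \<open>separation_grid\<close> with \<open>\<kappa> = 0\<close> their separation is small. Hence
  \<open>\<parallel>x - y\<parallel>\<^sup>2\<close> and \<open>t\<^sup>2 (f x - f y)\<^sup>2\<close> nearly agree for the values \<open>x, y\<close> at \<open>t\<close> of two approximations.
  Helly-type selection makes the energies converge at every dyadic time, and then the points form a
  Cauchy sequence.
\<close>

lemma dyadic_descent:
  assumes x0: "x0 \<in> D"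
  obtains u where "stable_descent (\<Union>n. dyadic n) u" "u 0 = x0"
proof -
  have "\<exists>u. stable_descent (dyadic n) u \<and> u 0 = x0 \<and> (\<forall>t. u t \<in> D \<and> f (u t) \<le> f x0)" for n
    using grid_descent[OF x0, of "1 / 2 ^ n"] unfolding dyadic_def by (metis zero_less_divide_1_iff zero_less_numeral zero_less_power)
  then obtain v where v: "\<And>n. stable_descent (dyadic n) (v n)" and v0: "\<And>n. v n 0 = x0"
    and vD: "\<And>n t. v n t \<in> D" and vle: "\<And>n t. f (v n t) \<le> f x0" by metis
  have "countable (\<Union>n. dyadic n)" by (simp add: dyadic_def)
  moreover have "norm (f (v n t)) \<le> f x0" for n t using vle nonneg[OF vD] by simp
  ultimately obtain k where k: "strict_mono (k::nat \<Rightarrow> nat)"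
    and conv: "\<And>t. t \<in> (\<Union>n. dyadic n) \<Longrightarrow> \<exists>l. (\<lambda>n. f (v (k n) t)) \<longlonglongrightarrow> l"
    using function_convergent_subsequence[of "\<Union>n. dyadic n" "\<lambda>n t. f (v n t)" "f x0"] by metis
  define V where "V n = v (k n)" for n
  have V: "stable_descent (dyadic m) (V n)" if "m \<le> n" for m n
    using stable_descent_mono[OF v dyadic_mono, of m "k n"] that seq_suble[OF k, of n]
    by (simp add: V_def)
  have V0: "V n 0 = x0" and VD: "V n t \<in> D" and Vle: "f (V n t) \<le> f x0" for n t
    by (simp_all add: V_def v0 vD vle)
  have f0: "0 \<le> f x0" using nonneg[OF x0] .
  have lim: "\<exists>x. (\<lambda>n. V n t) \<longlonglongrightarrow> x \<and> (\<lambda>n. f (V n t)) \<longlonglongrightarrow> f x \<and> stable_at t x"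
    if t: "t \<in> dyadic N" for t N
  proof -
    have t0: "0 \<le> t" using dyadic_nonneg[OF t] .
    obtain l where l: "(\<lambda>n. f (V n t)) \<longlonglongrightarrow> l" using conv t unfolding V_def by blast
    define C where "C = t + (2 * t * f x0)\<^sup>2 / 2 + t * f x0"
    have gap: "separation t (V m t) (V n t) \<le> 2 * sqrt (1 / 2 ^ p) * C * f x0"
      if p: "N \<le> p" "p \<le> m" "p \<le> n" "sqrt (1 / 2 ^ p) * f x0 \<le> 1" for m n p
    proof -
      obtain i where i: "t = real i * (1 / 2 ^ p)"
        using t dyadic_mono[OF p(1)] unfolding dyadic_def by blast
      have "0 + real j * (1 / 2 ^ p) \<in> dyadic p" for j by (auto simp: dyadic_def)
      then have "separation (0 + real i * (1 / 2 ^ p)) (V m (0 + real i * (1 / 2 ^ p))) (V n (0 + real i * (1 / 2 ^ p)))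
          + 0 / 2 * ((0 + real i * (1 / 2 ^ p))\<^sup>2 - 0\<^sup>2)
        \<le> separation 0 (V m 0) (V n 0)
          + 2 * sqrt (1 / 2 ^ p) * (t + (2 * t * f x0)\<^sup>2 / 2 + t * f x0) * f x0"
        using i by (intro separation_grid[OF V[OF p(2)] V[OF p(3)] _ order_refl _ _ _ Vle Vle p(4)])
          (simp_all add: V0)
      then show ?thesis unfolding i[symmetric] by (simp add: V0 separation_def C_def)
    qed
    have s0: "(\<lambda>p. sqrt (1 / 2 ^ p)) \<longlonglongrightarrow> 0"
      using tendsto_real_sqrt[OF LIMSEQ_divide_realpow_zero[of 2 1]] by simp
    have "Cauchy (\<lambda>n. V n t)"
    proof (rule metric_CauchyI)
      fix e :: real assume e: "0 < e"
      then have e2: "0 < e\<^sup>2 / 4" by simp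
      have "(\<lambda>p. sqrt (1 / 2 ^ p) * f x0) \<longlonglongrightarrow> 0" "(\<lambda>p. 2 * sqrt (1 / 2 ^ p) * C * f x0) \<longlonglongrightarrow> 0"
        using s0 by (intro tendsto_mult_left_zero tendsto_mult_right_zero; simp)+
      then have "eventually (\<lambda>p. N \<le> p \<and> sqrt (1 / 2 ^ p) * f x0 < 1 \<and> 2 * sqrt (1 / 2 ^ p) * C * f x0 < e\<^sup>2 / 4) sequentially"
        using e2 by (intro eventually_conj order_tendstoD(2) eventually_ge_at_top) auto
      then obtain p where p: "N \<le> p" "sqrt (1 / 2 ^ p) * f x0 < 1" "2 * sqrt (1 / 2 ^ p) * C * f x0 < e\<^sup>2 / 4"
        by (auto simp: eventually_sequentially)
      have "Cauchy (\<lambda>n. t * f (V n t))"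
        by (intro LIMSEQ_imp_Cauchy) (rule tendsto_mult_left[OF l])
      from metric_CauchyD[OF this, of "e / 2"] e obtain P
        where P: "\<And>m n. P \<le> m \<Longrightarrow> P \<le> n \<Longrightarrow> dist (t * f (V m t)) (t * f (V n t)) < e / 2" by auto
      show "\<exists>M. \<forall>m\<ge>M. \<forall>n\<ge>M. dist (V m t) (V n t) < e"
      proof (intro exI[of _ "max p P"] allI impI)
        fix m n assume mn: "max p P \<le> m" "max p P \<le> n"
        have "\<bar>t * (f (V m t) - f (V n t))\<bar> \<le> e / 2"
          using P[of m n] mn by (simp add: dist_real_def right_diff_distrib)
        then have "(t * (f (V m t) - f (V n t)))\<^sup>2 \<le> (e / 2)\<^sup>2"
          using abs_le_square_iff e by (metis abs_of_pos half_gt_zero)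
        then have "(t * (f (V m t) - f (V n t)))\<^sup>2 \<le> e\<^sup>2 / 4" by (simp add: power_divide)
        moreover have "((norm (V m t - V n t))\<^sup>2 - (t * (f (V m t) - f (V n t)))\<^sup>2) / 2 < e\<^sup>2 / 4"
          using gap[of p m n] p mn unfolding separation_def by simp
        moreover have "x < E" if "y \<le> E / 4" "(x - y) / 2 < E / 4" "0 < E" for x y E :: real
          using that by simp
        ultimately have "(norm (V m t - V n t))\<^sup>2 < e\<^sup>2" using e by (meson zero_less_power)
        then show "dist (V m t) (V n t) < e"
          using e by (simp add: dist_norm power_less_imp_less_base)
      qed
    qed
    then obtain x where x: "(\<lambda>n. V n t) \<longlonglongrightarrow> x" using Cauchy_convergent convergent_def by blast
    have st: "stable_at t (V (n + N) t)" for n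
      using descent_stable[OF V[of N "n + N"]] t by simp
    note sl = stable_limit[OF st tendsto_const t0 LIMSEQ_ignore_initial_segment[OF x]
        LIMSEQ_ignore_initial_segment[OF l]]
    have "l = f x"
    proof (cases "t = 0")
      case True
      then have "x = x0" "l = f x0" using x l by (auto simp: V0 LIMSEQ_const_iff)
      then show ?thesis by simp
    next
      case False then show ?thesis using sl(2) t0 by simp
    qed
    then show ?thesis using x l sl(1) by blast
  qed
  define u where "u t = lim (\<lambda>n. V n t)" for t
  have u: "(\<lambda>n. V n t) \<longlonglongrightarrow> u t" "(\<lambda>n. f (V n t)) \<longlonglongrightarrow> f (u t)" "stable_at t (u t)"
    if "t \<in> dyadic N" for t N
    using lim[OF that] by (auto simp: u_def limI)
  have "norm (u b - u a) \<le> b * (f (u a) - f (u b))"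
    if ab: "a \<in> dyadic m" "b \<in> dyadic n" "a \<le> b" for a b m n
  proof (rule LIMSEQ_le[of "\<lambda>i. norm (V i b - V i a)" _ "\<lambda>i. b * (f (V i a) - f (V i b))"])
    have "norm (V i b - V i a) \<le> b * (f (V i a) - f (V i b))" if "i \<ge> max m n" for i
      using descent_bound[OF V[OF that], of a b] dyadic_mono[of m "max m n"]
        dyadic_mono[of n "max m n"] ab by auto
    then show "\<exists>N. \<forall>i\<ge>N. norm (V i b - V i a) \<le> b * (f (V i a) - f (V i b))" by blast
  qed (intro tendsto_intros u[OF ab(1)] u[OF ab(2)])+
  then have "stable_descent (\<Union>n. dyadic n) u"
    unfolding stable_descent_def using u(3) by blast
  moreover have "u 0 = x0"
    using u(1)[OF zero_dyadic] by (simp add: V0 LIMSEQ_const_iff)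
  ultimately show ?thesis using that by blast
qed

text \<open>
  The largest dyadic number of level \<open>n\<close> strictly below \<open>t\<close>; truncation in \<^const>\<open>nat\<close> makes it 0 at
  \<open>t = 0\<close>, so that the initial value is kept.
\<close>

definition dyadic_below :: "nat \<Rightarrow> real \<Rightarrow> real" where
  "dyadic_below n t = real (nat (\<lceil>t * 2 ^ n\<rceil> - 1)) * (1 / 2 ^ n)"

lemma dyadic_below_in: "dyadic_below n t \<in> dyadic n"
  by (simp add: dyadic_below_def dyadic_def)

lemma dyadic_below_0: "dyadic_below n 0 = 0"
  by (simp add: dyadic_below_def)

lemma dyadic_below_mono: "s \<le> t \<Longrightarrow> dyadic_below n s \<le> dyadic_below n t"
  unfolding dyadic_below_def
  by (intro mult_right_mono of_nat_mono nat_mono diff_right_mono ceiling_mono) auto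

lemma dyadic_below_bounds:
  assumes "0 < t"
  shows "dyadic_below n t < t" "t - 1 / 2 ^ n \<le> dyadic_below n t"
proof -
  have "0 < t * 2 ^ n" using assms by simp
  then have "1 \<le> \<lceil>t * 2 ^ n\<rceil>" by linarith
  then have eq: "dyadic_below n t * 2 ^ n = real_of_int \<lceil>t * 2 ^ n\<rceil> - 1"
    by (simp add: dyadic_below_def)
  then have "dyadic_below n t * 2 ^ n < t * 2 ^ n" "t * 2 ^ n - 1 \<le> dyadic_below n t * 2 ^ n"
    by linarith+
  then show "dyadic_below n t < t" "t - 1 / 2 ^ n \<le> dyadic_below n t"
    by (auto simp: field_simps)
qed

lemma dyadic_below_Suc: "dyadic_below n t \<le> dyadic_below (Suc n) t"
proof -
  have "2 * (\<lceil>t * 2 ^ n\<rceil> - 1) \<le> \<lceil>t * 2 ^ Suc n\<rceil> - 1"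
    by (simp add: ceiling_le_iff) linarith
  moreover have "2 * nat i \<le> nat j" if "2 * i \<le> j" for i j :: int using that by linarith
  ultimately have "2 * nat (\<lceil>t * 2 ^ n\<rceil> - 1) \<le> nat (\<lceil>t * 2 ^ Suc n\<rceil> - 1)" by blast
  then have "real (2 * nat (\<lceil>t * 2 ^ n\<rceil> - 1)) \<le> real (nat (\<lceil>t * 2 ^ Suc n\<rceil> - 1))"
    by (simp only: of_nat_le_iff)
  then show ?thesis by (simp add: dyadic_below_def field_simps)
qed

lemma dyadic_below_tendsto: "0 \<le> t \<Longrightarrow> (\<lambda>n. dyadic_below n t) \<longlonglongrightarrow> t"
proof (cases "t = 0")
  case False
  assume "0 \<le> t"
  with False have t: "0 < t" by simp
  have lim: "(\<lambda>n. t - 1 / 2 ^ n) \<longlonglongrightarrow> t"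
    using tendsto_diff[OF tendsto_const[of t] LIMSEQ_divide_realpow_zero[of 2 1]] by simp
  show ?thesis
  proof (rule tendsto_sandwich[OF always_eventually always_eventually lim tendsto_const])
    show "\<forall>n. t - 1 / 2 ^ n \<le> dyadic_below n t" using dyadic_below_bounds(2)[OF t] by blast
    show "\<forall>n. dyadic_below n t \<le> t" using dyadic_below_bounds(1)[OF t] less_imp_le by blast
  qed
qed (simp add: dyadic_below_0)

text \<open>
  The value at \<open>t > 0\<close> is the limit of the dyadic solution from the left, even when \<open>t\<close> is itself
  dyadic: at a jump the dyadic solution may already have taken the later value. Stability and the
  energy estimate pass to this limit by \<open>stable_limit\<close>.
\<close>

lemma left_continuous_descent_exists:
  assumes x0: "x0 \<in> D"
  obtains u where "stable_descent {0..} u" "u 0 = x0" "\<And>t. 0 < t \<Longrightarrow> (u \<longlongrightarrow> u t) (at_left t)"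
proof -
  let ?Q = "\<Union>n. dyadic n"
  obtain U where U: "stable_descent ?Q U" and U0: "U 0 = x0" using dyadic_descent[OF x0] .
  have inQ: "dyadic_below n t \<in> ?Q" for n t using dyadic_below_in by blast
  have nn: "0 \<le> dyadic_below n t" for n t using dyadic_nonneg[OF dyadic_below_in] .
  define X where "X n t = U (dyadic_below n t)" for n t
  have Xst: "stable_at (dyadic_below n t) (X n t)" for n t
    using descent_stable[OF U inQ] by (simp add: X_def)
  have XD: "X n t \<in> D" for n t using Xst stable_at_in by blast
  have Xb: "norm (X n t - X m s) \<le> dyadic_below n t * (f (X m s) - f (X n t))"
    "f (X n t) \<le> f (X m s)"
    if "dyadic_below m s \<le> dyadic_below n t" for m n s t
    using descent_bound[OF U inQ inQ that] descent_energy_decreasing[OF U inQ inQ nn that]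
    by (simp_all add: X_def)
  have incr: "dyadic_below m t \<le> dyadic_below n t" if "m \<le> n" for m n t
    using lift_Suc_mono_le[of "\<lambda>n. dyadic_below n t"] dyadic_below_Suc that by blast
  have lim: "\<exists>x. (\<lambda>n. X n t) \<longlonglongrightarrow> x \<and> (\<lambda>n. f (X n t)) \<longlonglongrightarrow> f x \<and> stable_at t x \<and> (\<forall>n. f x \<le> f (X n t))"
    if t: "0 \<le> t" for t
  proof (cases "t = 0")
    case True
    then show ?thesis using stable_at_0[OF x0] by (auto simp: X_def dyadic_below_0 U0)
  next
    case False
    then have t: "0 < t" using t by simp
    have "norm (X n t - X m t) \<le> t * (f (X m t) - f (X n t))" if "m \<le> n" for m n
    proof -
      have "dyadic_below n t * (f (X m t) - f (X n t)) \<le> t * (f (X m t) - f (X n t))"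
        using Xb(2)[OF incr[OF that]] dyadic_below_bounds[OF t, of n] by (intro mult_right_mono) auto
      then show ?thesis using Xb(1)[OF incr[OF that]] order_trans by blast
    qed
    then obtain x l where x: "(\<lambda>n. X n t) \<longlonglongrightarrow> x" and l: "(\<lambda>n. f (X n t)) \<longlonglongrightarrow> l" "\<And>n. l \<le> f (X n t)"
      using Cauchy_by_energy[of "\<lambda>n. X n t" t] XD t by blast
    have "stable_at t x" "l = f x"
      using stable_limit[OF Xst dyadic_below_tendsto _ x l(1)] t by auto
    then show ?thesis using x l by blast
  qed
  define u where "u t = lim (\<lambda>n. X n t)" for t
  have u: "(\<lambda>n. X n t) \<longlonglongrightarrow> u t" "(\<lambda>n. f (X n t)) \<longlonglongrightarrow> f (u t)" "stable_at t (u t)"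
    "f (u t) \<le> f (X n t)" if "0 \<le> t" for t n
    using lim[OF that] by (auto simp: u_def limI)
  have ub: "norm (u b - u a) \<le> b * (f (u a) - f (u b))" if ab: "0 \<le> a" "a \<le> b" for a b
  proof -
    have b: "0 \<le> b" using ab by simp
    show ?thesis
      by (rule LIMSEQ_le[of "\<lambda>n. norm (X n b - X n a)" _ "\<lambda>n. dyadic_below n b * (f (X n a) - f (X n b))"])
        (use Xb(1)[OF dyadic_below_mono[OF ab(2)]] in
          \<open>auto intro!: tendsto_intros u[OF ab(1)] u[OF b] dyadic_below_tendsto[OF b]\<close>)
  qed
  then have "stable_descent {0..} u" unfolding stable_descent_def using u(3) by auto
  moreover have "u 0 = x0" by (simp add: u_def X_def dyadic_below_0 U0)
  moreover have "(u \<longlongrightarrow> u t) (at_left t)" if t: "0 < t" for t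
  proof (rule tendstoI)
    fix e :: real assume e: "0 < e"
    then have "eventually (\<lambda>n. f (X n t) < f (u t) + e / t) sequentially"
      using order_tendstoD(2)[OF u(2)] t by simp
    then obtain N where N: "f (X N t) < f (u t) + e / t" by (auto simp: eventually_sequentially)
    show "eventually (\<lambda>s. dist (u s) (u t) < e) (at_left t)"
      using eventually_at_left_real[OF dyadic_below_bounds(1)[OF t, of N]]
    proof eventually_elim
      case (elim s)
      then have s: "dyadic_below N t < s" "s < t" "0 \<le> s" using nn[of N t] by auto
      obtain m where "dyadic_below N t < dyadic_below m s"
        using order_tendstoD(1)[OF dyadic_below_tendsto[OF s(3)] s(1)]
        by (auto simp: eventually_sequentially)
      then have "f (u s) \<le> f (X N t)" using u(4)[OF s(3), of m] Xb(2)[of N t m s] by simp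
      then have "t * (f (u s) - f (u t)) < t * (e / t)" using N t by (intro mult_strict_left_mono) auto
      then show ?case using ub[of s t] s t by (simp add: dist_norm norm_minus_commute)
    qed
  qed
  ultimately show ?thesis using that by blast
qed

section \<open>Variation of a stable descent\<close>

lemma descent_energy_integrable:
  assumes u: "stable_descent {0..} u" and "0 \<le> a"
  shows "(\<lambda>t. f (u t)) integrable_on {a..b}"
proof -
  have "mono_on {a..b} (\<lambda>t. - f (u t))"
    using descent_energy_decreasing[OF u] \<open>0 \<le> a\<close> by (auto simp: mono_on_def)
  then show ?thesis using integrable_on_mono_on integrable_neg_iff by blast
qed

text \<open>
  The value that the energy balance prescribes for the variation over \<open>[a, b]\<close>. It is additive in
  the interval, as the variation is.
\<close>

definition dissipation :: "(real \<Rightarrow> 'a) \<Rightarrow> real \<Rightarrow> real \<Rightarrow> real" where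
  "dissipation u a b = a * f (u a) - b * f (u b) + integral {a..b} (\<lambda>t. f (u t))"

lemma dissipation_add:
  assumes "stable_descent {0..} u" "0 \<le> a" "a \<le> b" "b \<le> c"
  shows "dissipation u a b + dissipation u b c = dissipation u a c"
  using Henstock_Kurzweil_Integration.integral_combine[OF assms(3,4) descent_energy_integrable[OF assms(1,2)]]
  by (simp add: dissipation_def)

lemma dissipation_self: "dissipation u a a = 0"
  by (simp add: dissipation_def)

text \<open>
  Upper and lower bounds on \<open>\<parallel>u b - u a\<parallel>\<close> and on the integral of the monotone energy all agree up to
  \<open>(b - a)\<close> times the energy loss; on a uniform partition these errors sum to mesh times total loss.
\<close>

lemma dissipation_close:
  assumes u: "stable_descent {0..} u" and ab: "0 \<le> a" "a \<le> b"
  shows "\<bar>norm (u b - u a) - dissipation u a b\<bar> \<le> (b - a) * (f (u a) - f (u b))"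
proof -
  note int = descent_energy_integrable[OF u ab(1), of b]
  have "integral {a..b} (\<lambda>t. f (u t)) \<le> integral {a..b} (\<lambda>t. f (u a))"
    using descent_energy_decreasing[OF u] ab by (intro integral_le int) auto
  moreover have "integral {a..b} (\<lambda>t. f (u b)) \<le> integral {a..b} (\<lambda>t. f (u t))"
    using descent_energy_decreasing[OF u] ab by (intro integral_le int) auto
  moreover have "norm (u b - u a) \<le> b * (f (u a) - f (u b))" "a * (f (u a) - f (u b)) \<le> norm (u b - u a)"
    using descent_bound[OF u, of a b] stable_descent_lower_bound[OF u, of a b] ab by auto
  ultimately show ?thesis using ab by (simp add: dissipation_def abs_le_iff algebra_simps)
qed

lemma dissipation_grid:
  assumes u: "stable_descent {0..} u" and a: "0 \<le> a" and \<delta>: "0 \<le> \<delta>"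
  shows "\<bar>(\<Sum>i<n. norm (u (a + real (Suc i) * \<delta>) - u (a + real i * \<delta>))) - dissipation u a (a + real n * \<delta>)\<bar>
    \<le> \<delta> * (f (u a) - f (u (a + real n * \<delta>)))"
proof (induction n)
  case 0
  then show ?case by (simp add: dissipation_self)
next
  case (Suc n)
  define g where "g i = a + real i * \<delta>" for i
  have g: "g (Suc n) - g n = \<delta>" "0 \<le> g n" "a \<le> g n" "g n \<le> g (Suc n)"
    using a \<delta> by (auto simp: g_def algebra_simps)
  have "\<bar>norm (u (g (Suc n)) - u (g n)) - dissipation u (g n) (g (Suc n))\<bar> \<le> \<delta> * (f (u (g n)) - f (u (g (Suc n))))"
    using dissipation_close[OF u g(2,4)] g(1) by simp
  moreover have "dissipation u a (g n) + dissipation u (g n) (g (Suc n)) = dissipation u a (g (Suc n))"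
    using dissipation_add[OF u a g(3,4)] .
  ultimately show ?case
    using Suc.IH unfolding g_def[symmetric] by (simp add: abs_le_iff right_diff_distrib)
qed

lemma dissipation_subdivision:
  assumes u: "stable_descent {0..} u" and a: "0 \<le> a" "a < b" and n: "0 < n"
  shows "\<bar>(\<Sum>i<n. norm (u (a + real (Suc i) * ((b - a) / real n)) - u (a + real i * ((b - a) / real n))))
    - dissipation u a b\<bar> \<le> (b - a) * (f (u a) - f (u b)) / real n"
  using dissipation_grid[OF u a(1), of "(b - a) / real n" n] a n by simp

lemma norm_le_dissipation:
  assumes u: "stable_descent {0..} u" and a: "0 \<le> a" "a \<le> b"
  shows "norm (u b - u a) \<le> dissipation u a b"
proof (cases "a = b")
  case True
  then show ?thesis by (simp add: dissipation_self)
next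
  case False
  then have ab: "a < b" using a by simp
  define g where "g n i = a + real i * ((b - a) / real n)" for n i
  have "norm (u b - u a) \<le> dissipation u a b + (b - a) * (f (u a) - f (u b)) / real n" if n: "0 < n" for n
  proof -
    have ends: "g n 0 = a" "g n n = b" using n by (auto simp: g_def)
    have "u b - u a = (\<Sum>i<n. u (g n (Suc i)) - u (g n i))"
      using sum_lessThan_telescope[of "\<lambda>i. u (g n i)" n] ends by simp
    then have "norm (u b - u a) \<le> (\<Sum>i<n. norm (u (g n (Suc i)) - u (g n i)))"
      using norm_sum by metis
    then show ?thesis
      using dissipation_subdivision[OF u a(1) ab n] unfolding g_def by linarith
  qed
  then have "eventually (\<lambda>n. norm (u b - u a) \<le> dissipation u a b + (b - a) * (f (u a) - f (u b)) / real n) sequentially"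
    by (rule eventually_mono[OF eventually_gt_at_top[of "0::nat"]])
  moreover have "(\<lambda>n. dissipation u a b + (b - a) * (f (u a) - f (u b)) / real n) \<longlonglongrightarrow> dissipation u a b + 0"
    by (intro tendsto_add tendsto_const lim_const_over_n)
  ultimately show ?thesis by (intro tendsto_lowerbound[of _ _ sequentially]) auto
qed

text \<open>
  Every partition sum is at most the dissipation by \<open>norm_le_dissipation\<close> and additivity; uniform
  partitions attain it in the limit by \<open>dissipation_subdivision\<close>.
\<close>

lemma variation_eq_dissipation:
  assumes u: "stable_descent {0..} u" and r: "0 \<le> r" "r < t"
  shows "variation u r t = ennreal (dissipation u r t)"
proof (rule antisym)
  show "variation u r t \<le> ennreal (dissipation u r t)"
    unfolding variation_def
  proof (rule Sup_least, safe)
    fix N :: nat and s :: "nat \<Rightarrow> real"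
    assume s: "r \<le> s 0" "strict_mono_on {0..N} s" "s N \<le> t"
    have ms: "s i \<le> s j" if "i \<le> j" "j \<le> N" for i j
      using strict_mono_on_leD[OF s(2), of i j] that by auto
    have "(\<Sum>j=1..m. norm (u (s j) - u (s (j - 1)))) \<le> dissipation u (s 0) (s m)" if "m \<le> N" for m
      using that
    proof (induction m)
      case 0
      then show ?case by (simp add: dissipation_self)
    next
      case (Suc m)
      have le: "s 0 \<le> s m" "s m \<le> s (Suc m)" "0 \<le> s 0" "0 \<le> s m"
        using ms[of 0 m] ms[of m "Suc m"] Suc.prems s r by auto
      then show ?case
        using Suc norm_le_dissipation[OF u le(4,2)] dissipation_add[OF u le(3,1,2)] by simp
    qed
    from this[of N] have "(\<Sum>j=1..N. norm (u (s j) - u (s (j - 1)))) \<le> dissipation u (s 0) (s N)" by simp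
    also have "\<dots> \<le> dissipation u r t"
    proof -
      have le: "s 0 \<le> s N" "0 \<le> s 0" "0 \<le> s N" "r \<le> s N" using ms[of 0 N] s r by auto
      have "0 \<le> dissipation u r (s 0)" "0 \<le> dissipation u (s N) t"
        using norm_le_dissipation[OF u r(1) s(1)] norm_le_dissipation[OF u le(3) s(3)] norm_ge_zero order_trans
        by blast+
      then show ?thesis
        using dissipation_add[OF u r(1) s(1) le(1)] dissipation_add[OF u r(1) le(4) s(3)] by linarith
    qed
    finally show "(\<Sum>j=1..N. ennreal (norm (u (s j) - u (s (j - 1))))) \<le> ennreal (dissipation u r t)"
      by (simp add: sum_ennreal ennreal_leI)
  qed
next
  define c where "c = (t - r) * (f (u r) - f (u t))"
  have "ennreal (dissipation u r t - c / real n) \<le> variation u r t" if n: "0 < n" for n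
  proof -
    define s where "s i = r + real i * ((t - r) / real n)" for i
    have "dissipation u r t - c / real n \<le> (\<Sum>i<n. norm (u (s (Suc i)) - u (s i)))"
      using dissipation_subdivision[OF u r n] unfolding s_def c_def by linarith
    then have "ennreal (dissipation u r t - c / real n) \<le> ennreal (\<Sum>i<n. norm (u (s (Suc i)) - u (s i)))"
      by (rule ennreal_leI)
    also have "\<dots> = (\<Sum>j=1..n. ennreal (norm (u (s j) - u (s (j - 1)))))"
      by (simp add: sum_ennreal sum.atLeast1_atMost_eq)
    also have "\<dots> \<le> variation u r t"
      unfolding variation_def
    proof (rule Sup_upper, rule CollectI, intro exI conjI, rule refl)
      show "r \<le> s 0" "s n \<le> t" using n by (auto simp: s_def)
      show "strict_mono_on {0..n} s"
        using r n by (auto simp: strict_mono_on_def s_def intro!: divide_strict_right_mono mult_strict_right_mono)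
    qed
    finally show ?thesis .
  qed
  then have "eventually (\<lambda>n. ennreal (dissipation u r t - c / real n) \<le> variation u r t) sequentially"
    by (rule eventually_mono[OF eventually_gt_at_top[of "0::nat"]])
  moreover have "(\<lambda>n. ennreal (dissipation u r t - c / real n)) \<longlonglongrightarrow> ennreal (dissipation u r t - 0)"
    by (intro tendsto_ennrealI tendsto_diff tendsto_const lim_const_over_n)
  ultimately show "ennreal (dissipation u r t) \<le> variation u r t"
    by (intro tendsto_upperbound[of _ _ sequentially]) auto
qed

end

section \<open>Energetic solutions as stable descents\<close>

text \<open>
  The limit inferior is taken over punctured neighbourhoods, so members of the sequence that are
  equal to \<open>x\<close> have to be accounted for separately.
\<close>

lemma lower_semicontinuous_sublevel:
  fixes X :: "nat \<Rightarrow> 'a::metric_space"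
  assumes J: "lower_semicontinuous J" and X: "X \<longlonglongrightarrow> x" and c: "\<And>n. J (X n) \<le> c"
  shows "J x \<le> c"
proof (rule ccontr)
  assume "\<not> J x \<le> c"
  then have less: "c < J x" by simp
  have "J x \<le> Liminf (at x) J" using J by (simp add: lower_semicontinuous_def)
  then have "eventually (\<lambda>y. c < J y) (at x)" using less by (simp add: le_Liminf_iff)
  then have "eventually (\<lambda>y. c < J y) (nhds x)" using less by (simp add: eventually_nhds_conv_at)
  then have "eventually (\<lambda>n. c < J (X n)) sequentially"
    by (rule eventually_compose_filterlim[OF _ X])
  then show False using c by (auto simp: eventually_sequentially not_less[symmetric])
qed

lemma ennreal_enn2real_domain: "x \<in> eff_domain J \<Longrightarrow> ennreal (enn2real (J x)) = J x"
  by (simp add: eff_domain_def)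

lemma convex_energy_of_functional:
  fixes J :: "'a::{real_inner, banach} \<Rightarrow> ennreal"
  assumes convex: "convex_functional J" and lsc: "lower_semicontinuous J"
  shows "convex_energy (eff_domain J) (\<lambda>x. enn2real (J x))"
proof
  have *: "J (a *\<^sub>R x + b *\<^sub>R y) \<le> ennreal (a * enn2real (J x) + b * enn2real (J y))"
    if "x \<in> eff_domain J" "y \<in> eff_domain J" "0 \<le> a" "0 \<le> b" "a + b = 1" for x y a b
  proof -
    have "J (a *\<^sub>R x + b *\<^sub>R y) \<le> ennreal a * J x + ennreal b * J y"
      using convex that by (simp add: convex_functional_def)
    also have "\<dots> = ennreal (a * enn2real (J x) + b * enn2real (J y))"
      using that by (simp add: ennreal_plus ennreal_mult ennreal_enn2real_domain)
    finally show ?thesis .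
  qed
  have conv: "convex (eff_domain J)"
  proof (rule convexI)
    fix x y :: 'a and a b :: real
    assume "x \<in> eff_domain J" "y \<in> eff_domain J" "0 \<le> a" "0 \<le> b" "a + b = 1"
    from *[OF this] show "a *\<^sub>R x + b *\<^sub>R y \<in> eff_domain J"
      by (simp add: eff_domain_def le_less_trans[OF _ ennreal_less_top])
  qed
  show "convex_on (eff_domain J) (\<lambda>x. enn2real (J x))"
    unfolding convex_on_def
  proof (intro conjI ballI allI impI conv)
    fix x y :: 'a and a b :: real
    assume "x \<in> eff_domain J" "y \<in> eff_domain J" "0 \<le> a" "0 \<le> b" "a + b = 1"
    from *[OF this] show "enn2real (J (a *\<^sub>R x + b *\<^sub>R y)) \<le> a * enn2real (J x) + b * enn2real (J y)"
      using \<open>0 \<le> a\<close> \<open>0 \<le> b\<close> by (intro enn2real_leI) auto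
  qed
  show "0 \<le> enn2real (J x)" for x by simp
  fix X :: "nat \<Rightarrow> 'a" and c x
  assume X: "\<And>n. X n \<in> eff_domain J \<and> enn2real (J (X n)) \<le> c" and lim: "X \<longlonglongrightarrow> x"
  have c: "0 \<le> c" using X[of 0] enn2real_nonneg order_trans by blast
  have "J (X n) \<le> ennreal c" for n
    using X[of n] ennreal_enn2real_domain[of "X n" J] ennreal_leI by metis
  then have "J x \<le> ennreal c" using lower_semicontinuous_sublevel[OF lsc lim] by blast
  then show "x \<in> eff_domain J \<and> enn2real (J x) \<le> c"
    using c by (auto simp: eff_domain_def enn2real_leI le_less_trans[OF _ ennreal_less_top])
qed

text \<open>
  Competitors of infinite energy impose no constraint: for \<open>t > 0\<close> their energy is infinite, and at
  \<open>t = 0\<close> the convention \<open>0 * \<infinity> = 0\<close> makes the left-hand side vanish.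
\<close>

lemma stable_at_iff_energy:
  fixes J :: "'a::{real_inner, banach} \<Rightarrow> ennreal"
  assumes J: "convex_energy (eff_domain J) (\<lambda>x. enn2real (J x))" and x: "x \<in> eff_domain J" and t: "0 \<le> t"
  shows "convex_energy.stable_at (eff_domain J) (\<lambda>x. enn2real (J x)) t x \<longleftrightarrow>
    (\<forall>v. energy J t x \<le> energy J t v + ennreal (norm (v - x)))"
proof -
  interpret convex_energy "eff_domain J" "\<lambda>x. enn2real (J x)" by (rule J)
  have fin: "energy J t v = ennreal (t * enn2real (J v))" if "v \<in> eff_domain J" for v
    using that t by (simp add: energy_def ennreal_mult ennreal_enn2real_domain)
  have "energy J t x \<le> energy J t v + ennreal (norm (v - x)) \<longleftrightarrow>
      t * enn2real (J x) \<le> t * enn2real (J v) + norm (v - x)" if "v \<in> eff_domain J" for v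
    using that x t by (simp add: fin ennreal_plus[symmetric] del: ennreal_plus)
  moreover have "energy J t x \<le> energy J t v + ennreal (norm (v - x))" if "v \<notin> eff_domain J" for v
  proof (cases "t = 0")
    case True
    then show ?thesis by (simp add: energy_def)
  next
    case False
    then have "energy J t v = top"
      using that t by (simp add: energy_def eff_domain_def less_top[symmetric] ennreal_mult_top)
    then show ?thesis by simp
  qed
  ultimately show ?thesis unfolding stable_at_def using x by blast
qed

lemma norm_le_variation:
  assumes "a < b"
  shows "ennreal (norm (u b - u a)) \<le> variation u a b"
  unfolding variation_def
proof (rule Sup_upper, rule CollectI, intro exI conjI)
  let ?s = "\<lambda>i::nat. if i = 0 then a else b"
  show "ennreal (norm (u b - u a)) = (\<Sum>j=1..1. ennreal (norm (u (?s j) - u (?s (j - 1)))))" by simp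
  show "a \<le> ?s 0" "?s 1 \<le> b" "strict_mono_on {0..1} ?s"
    using assms by (auto simp: strict_mono_on_def)
qed

lemma energetic_solution_domain:
  assumes u: "stable J u" and dom: "eff_domain J \<noteq> {}" and t: "0 < t"
  shows "u t \<in> eff_domain J"
proof -
  obtain v where v: "J v < \<infinity>" using dom by (auto simp: eff_domain_def)
  have "energy J t (u t) \<le> energy J t v + ennreal (norm (v - u t))"
    using u t by (simp add: stable_def)
  also have "\<dots> < \<infinity>" using v by (simp add: energy_def ennreal_mult_less_top)
  finally have "ennreal t * J (u t) < \<infinity>" by (simp add: energy_def)
  then show ?thesis using t by (auto simp: eff_domain_def ennreal_mult_less_top)
qed

text \<open>
  The energy balance gives \<open>c j(c) \<le> a j(a) + \<integral>\<^sub>a\<^sup>c j\<close>, an integral inequality of Gronwall type. With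
  \<open>S\<close> the supremum of \<open>j\<close> on \<open>[a, b]\<close>, which is finite by local integrability, it says that \<open>j(c)\<close> is at
  most the mean of \<open>j(a)\<close> and \<open>S\<close> with weights \<open>a/c\<close> and \<open>1 - a/c\<close>. As \<open>a/c \<ge> a/b > 0\<close>, taking the
  supremum over \<open>c\<close> forces \<open>S \<le> j(a)\<close>.
\<close>

lemma energetic_solution_energy_decreasing:
  assumes u: "energetic_solution J u" and dom: "eff_domain J \<noteq> {}" and ab: "0 < a" "a \<le> b"
  shows "enn2real (J (u b)) \<le> enn2real (J (u a))"
proof (cases "a = b")
  case False
  define j where "j t = enn2real (J (u t))" for t
  have jJ: "J (u t) = ennreal (j t)" "0 \<le> j t" if "0 < t" for t
    using energetic_solution_domain[OF _ dom that] u
    by (auto simp: energetic_solution_def j_def ennreal_enn2real_domain)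
  have bal: "ennreal c * ennreal (j c) \<le> ennreal a * ennreal (j a) + (\<integral>\<^sup>+\<tau>. J (u \<tau>) \<partial>lebesgue_on {a..c})"
    if "a < c" for c
  proof -
    have "energy J c (u c) \<le> energy J c (u c) + variation u a c" by simp
    also have "\<dots> = energy J a (u a) + (\<integral>\<^sup>+\<tau>. J (u \<tau>) \<partial>lebesgue_on {a..c})"
      using u that ab by (simp add: energetic_solution_def energy_balance_def)
    finally show ?thesis using jJ[of a] jJ[of c] that ab by (simp add: energy_def)
  qed
  have bound: "c * j c \<le> a * j a + (c - a) * S"
    if c: "a \<le> c" "c \<le> b" and S: "\<And>t. a \<le> t \<Longrightarrow> t \<le> b \<Longrightarrow> j t \<le> S" "0 \<le> S" for c S
  proof (cases "a = c")
    case False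
    have "(\<integral>\<^sup>+\<tau>. J (u \<tau>) \<partial>lebesgue_on {a..c}) \<le> (\<integral>\<^sup>+\<tau>. ennreal S \<partial>lebesgue_on {a..c})"
      using S c ab by (intro nn_integral_mono) (auto simp: space_restrict_space jJ intro!: ennreal_leI)
    also have "\<dots> = ennreal (S * (c - a))"
      using c S by (simp add: emeasure_restrict_space space_restrict_space ennreal_mult)
    finally have "ennreal c * ennreal (j c) \<le> ennreal a * ennreal (j a) + ennreal (S * (c - a))"
      using bal[of c] c False by (meson add_left_mono order_trans less_le)
    also have "\<dots> = ennreal (a * j a + S * (c - a))"
      using c ab S jJ by (simp add: ennreal_mult ennreal_plus)
    finally have "ennreal (c * j c) \<le> ennreal (a * j a + S * (c - a))"
      using c ab jJ by (simp add: ennreal_mult)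
    then have "c * j c \<le> a * j a + S * (c - a)"
      using c ab S jJ by (subst (asm) ennreal_le_iff) auto
    then show ?thesis by (simp add: mult.commute)
  qed simp
  have bdd: "bdd_above (j ` {a..b})"
  proof -
    define K where "K = ennreal a * ennreal (j a) + (\<integral>\<^sup>+\<tau>. J (u \<tau>) \<partial>lebesgue_on {a..b})"
    have "(\<integral>\<^sup>+\<tau>. J (u \<tau>) \<partial>lebesgue_on {a..b}) < \<infinity>"
      using u ab by (auto simp: energetic_solution_def L1_loc_def)
    then have Kfin: "K < \<infinity>" by (simp add: K_def ennreal_mult_less_top)
    have "j c \<le> enn2real K / a" if "c \<in> {a..b}" for c
    proof -
      have c: "a \<le> c" "c \<le> b" "0 < c" using that ab by auto
      have "ennreal c * ennreal (j c) \<le> K"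
      proof (cases "a = c")
        case True then show ?thesis by (simp add: K_def)
      next
        case False
        then have "ennreal c * ennreal (j c) \<le> ennreal a * ennreal (j a) + (\<integral>\<^sup>+\<tau>. J (u \<tau>) \<partial>lebesgue_on {a..c})"
          using bal c by simp
        also have "(\<integral>\<^sup>+\<tau>. J (u \<tau>) \<partial>lebesgue_on {a..c}) \<le> (\<integral>\<^sup>+\<tau>. J (u \<tau>) \<partial>lebesgue_on {a..b})"
          using c by (simp add: nn_integral_restrict_space nn_integral_mono indicator_def mult_mono)
        finally show ?thesis by (simp add: K_def add_left_mono)
      qed
      then have "ennreal (c * j c) \<le> K" using c jJ by (simp add: ennreal_mult)
      then have "enn2real (ennreal (c * j c)) \<le> enn2real K" using Kfin by (intro enn2real_mono) auto
      then have "c * j c \<le> enn2real K" using c jJ by simp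
      moreover have "a * j c \<le> c * j c" using c jJ by (intro mult_right_mono) auto
      ultimately show ?thesis using ab by (simp add: field_simps)
    qed
    then show ?thesis by (rule bdd_aboveI2)
  qed
  define S where "S = (SUP t\<in>{a..b}. j t)"
  have jS: "j t \<le> S" if "a \<le> t" "t \<le> b" for t
    unfolding S_def using that by (intro cSUP_upper bdd) auto
  have S0: "0 \<le> S" "j a \<le> S" using jS[of a] jJ[of a] ab by auto
  have "S \<le> S - a / b * (S - j a)"
  proof -
    have "j c \<le> S - a / b * (S - j a)" if "c \<in> {a..b}" for c
    proof -
      have c: "a \<le> c" "c \<le> b" "0 < c" using that ab by auto
      have "c * j c \<le> c * S - a * (S - j a)"
        using bound[OF c(1,2) jS S0(1)] by (simp add: algebra_simps)
      then have "j c \<le> S - a / c * (S - j a)" using c by (simp add: field_simps)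
      also have "a / b * (S - j a) \<le> a / c * (S - j a)"
        using c ab S0 by (intro mult_right_mono divide_left_mono) auto
      then have "S - a / c * (S - j a) \<le> S - a / b * (S - j a)" by simp
      finally show ?thesis .
    qed
    then show ?thesis unfolding S_def using ab by (intro cSUP_least) auto
  qed
  then have "S \<le> j a" using ab by (auto simp: zero_le_mult_iff divide_le_0_iff mult_le_0_iff)
  then show ?thesis using jS[of b] ab by (simp add: j_def)
qed simp

text \<open>
  Bounding the integral in the energy balance by \<open>(b - a) j(a)\<close> turns it into the upper estimate of
  a stable descent. Time 0 is excluded because stability
  yields a finite energy at positive times.
\<close>

lemma energetic_solution_imp_stable_descent:
  fixes J :: "'a::{real_inner, banach} \<Rightarrow> ennreal"
  assumes J: "convex_energy (eff_domain J) (\<lambda>x. enn2real (J x))"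
    and u: "energetic_solution J u" and dom: "eff_domain J \<noteq> {}"
  shows "convex_energy.stable_descent (eff_domain J) (\<lambda>x. enn2real (J x)) {0<..} u"
proof -
  interpret convex_energy "eff_domain J" "\<lambda>x. enn2real (J x)" by (rule J)
  have st: "stable J u" using u by (simp add: energetic_solution_def)
  define j where "j t = enn2real (J (u t))" for t
  have jJ: "J (u t) = ennreal (j t)" "0 \<le> j t" "u t \<in> eff_domain J" if "0 < t" for t
    using energetic_solution_domain[OF st dom that] by (auto simp: j_def ennreal_enn2real_domain)
  have "norm (u b - u a) \<le> b * (j a - j b)" if ab: "0 < a" "a < b" for a b
  proof -
    have "(\<integral>\<^sup>+\<tau>. J (u \<tau>) \<partial>lebesgue_on {a..b}) \<le> (\<integral>\<^sup>+\<tau>. ennreal (j a) \<partial>lebesgue_on {a..b})"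
      using energetic_solution_energy_decreasing[OF u dom] ab
      by (intro nn_integral_mono) (auto simp: space_restrict_space jJ j_def[symmetric] intro!: ennreal_leI)
    also have "\<dots> = ennreal (j a * (b - a))"
      using ab jJ by (simp add: emeasure_restrict_space space_restrict_space ennreal_mult)
    finally have int: "(\<integral>\<^sup>+\<tau>. J (u \<tau>) \<partial>lebesgue_on {a..b}) \<le> ennreal (j a * (b - a))" .
    have "ennreal (b * j b + norm (u b - u a)) = energy J b (u b) + ennreal (norm (u b - u a))"
      using ab jJ by (simp add: energy_def ennreal_mult ennreal_plus)
    also have "\<dots> \<le> energy J b (u b) + variation u a b"
      using norm_le_variation[OF ab(2)] by (rule add_left_mono)
    also have "\<dots> = energy J a (u a) + (\<integral>\<^sup>+\<tau>. J (u \<tau>) \<partial>lebesgue_on {a..b})"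
      using u ab by (simp add: energetic_solution_def energy_balance_def)
    also have "\<dots> \<le> energy J a (u a) + ennreal (j a * (b - a))" using int by (rule add_left_mono)
    also have "\<dots> = ennreal (a * j a + j a * (b - a))"
      using ab jJ by (simp add: energy_def ennreal_mult ennreal_plus)
    finally have "b * j b + norm (u b - u a) \<le> a * j a + j a * (b - a)"
      using ab jJ by (subst (asm) ennreal_le_iff) auto
    then show ?thesis by (simp add: algebra_simps)
  qed
  then have "norm (u b - u a) \<le> b * (j a - j b)" if "0 < a" "a \<le> b" for a b
    using that by (cases "a = b") auto
  moreover have "stable_at t (u t)" if "0 < t" for t
    using st that stable_at_iff_energy[OF J jJ(3)[OF that], of t] by (simp add: stable_def)
  ultimately show ?thesis unfolding stable_descent_def j_def by auto
qed

lemma stable_descent_imp_energetic_solution: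
  fixes J :: "'a::{real_inner, banach} \<Rightarrow> ennreal"
  assumes J: "convex_energy (eff_domain J) (\<lambda>x. enn2real (J x))"
    and u: "convex_energy.stable_descent (eff_domain J) (\<lambda>x. enn2real (J x)) {0..} u"
  shows "energetic_solution J u"
proof -
  interpret convex_energy "eff_domain J" "\<lambda>x. enn2real (J x)" by (rule J)
  define j where "j t = enn2real (J (u t))" for t
  have jJ: "J (u t) = ennreal (j t)" "0 \<le> j t" "u t \<in> eff_domain J" if "0 \<le> t" for t
    using descent_in[OF u, of t] that by (auto simp: j_def ennreal_enn2real_domain)
  have dec: "j b \<le> j a" if "0 \<le> a" "a \<le> b" for a b
    using descent_energy_decreasing[OF u] that by (simp add: j_def)
  \<comment> \<open>Freezing the time at 0 on the negative half-line gives a function that is monotone on all reals.\<close>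
  have "mono (\<lambda>t. - j (max 0 t))" by (rule monoI) (auto intro!: dec)
  then have "(\<lambda>t. - (- j (max 0 t))) \<in> borel_measurable borel"
    by (intro borel_measurable_uminus borel_measurable_mono)
  then have "(\<lambda>t. ennreal (j (max 0 t))) \<in> borel_measurable lborel" by simp
  then have meas: "(\<lambda>t. ennreal (j (max 0 t))) \<in> borel_measurable lebesgue"
    by (rule measurable_completion)
  have L1: "L1_loc (\<lambda>t. J (u t))"
    unfolding L1_loc_def
  proof (intro conjI allI impI)
    have "(\<lambda>t. ennreal (j (max 0 t))) \<in> borel_measurable (lebesgue_on {0..})"
      using meas by (rule measurable_restrict_space1)
    then show "(\<lambda>t. J (u t)) \<in> borel_measurable (lebesgue_on {0..})"
      by (rule measurable_cong[THEN iffD1, rotated]) (auto simp: space_restrict_space jJ)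
    fix K :: "real set" assume K: "compact K" "K \<subseteq> {0..}"
    have Kl: "K \<in> sets lebesgue" using K by (simp add: borel_compact)
    have "(\<integral>\<^sup>+\<tau>. J (u \<tau>) \<partial>lebesgue_on K) \<le> (\<integral>\<^sup>+\<tau>. ennreal (j 0) \<partial>lebesgue_on K)"
      using K by (intro nn_integral_mono) (auto simp: space_restrict_space jJ subset_iff intro!: ennreal_leI dec)
    also have "\<dots> = ennreal (j 0) * emeasure lebesgue K"
      using Kl by (simp add: emeasure_restrict_space space_restrict_space)
    also have "\<dots> < \<infinity>"
      using emeasure_compact_finite[OF K(1)] K by (simp add: ennreal_mult_less_top borel_compact)
    finally show "(\<integral>\<^sup>+\<tau>. J (u \<tau>) \<partial>lebesgue_on K) < \<infinity>" .
  qed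
  have "stable J u"
    unfolding stable_def
    using descent_stable[OF u] stable_at_iff_energy[OF J jJ(3)] by auto
  moreover have "energy_balance J u"
    unfolding energy_balance_def
  proof (intro allI impI)
    fix r t :: real assume r: "0 \<le> r" "r < t"
    let ?I = "integral {r..t} j"
    have hi: "(j has_integral ?I) {r..t}"
      using descent_energy_integrable[OF u r(1), of t] by (simp add: j_def[abs_def] integrable_integral)
    have "(\<integral>\<^sup>+\<tau>. J (u \<tau>) \<partial>lebesgue_on {r..t}) = (\<integral>\<^sup>+\<tau>. ennreal (j (max 0 \<tau>)) \<partial>lebesgue_on {r..t})"
      using r by (intro nn_integral_cong) (auto simp: space_restrict_space jJ)
    also have "\<dots> = (\<integral>\<^sup>+\<tau>. ennreal (j (max 0 \<tau>)) * indicator {r..t} \<tau> \<partial>lborel)"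
      using meas by (simp add: nn_integral_restrict_space nn_integral_completion)
    also have "\<dots> = (\<integral>\<^sup>+\<tau>. ennreal (j \<tau>) * indicator {r..t} \<tau> \<partial>lborel)"
      using r by (intro nn_integral_cong) (auto simp: indicator_def)
    also have "\<dots> = ennreal ?I"
      using nn_integral_has_integral_lebesgue'[OF _ hi] jJ r by simp
    finally have int: "(\<integral>\<^sup>+\<tau>. J (u \<tau>) \<partial>lebesgue_on {r..t}) = ennreal ?I" .
    have I0: "0 \<le> ?I" using jJ r by (intro integral_nonneg has_integral_integrable[OF hi]) auto
    have V0: "0 \<le> dissipation u r t" using norm_le_dissipation[OF u r(1)] r norm_ge_zero order_trans less_imp_le by metis
    have "energy J t (u t) + variation u r t = ennreal (t * j t + dissipation u r t)"
      using r jJ V0 by (simp add: energy_def variation_eq_dissipation[OF u r] ennreal_mult ennreal_plus)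
    also have "t * j t + dissipation u r t = r * j r + ?I" by (simp add: dissipation_def j_def[abs_def])
    also have "ennreal (r * j r + ?I) = energy J r (u r) + (\<integral>\<^sup>+\<tau>. J (u \<tau>) \<partial>lebesgue_on {r..t})"
      using r jJ I0 by (simp add: energy_def int ennreal_mult ennreal_plus)
    finally show "energy J t (u t) + variation u r t = energy J r (u r) + (\<integral>\<^sup>+\<tau>. J (u \<tau>) \<partial>lebesgue_on {r..t})" .
  qed
  moreover have "(u \<longlongrightarrow> u 0) (at_right 0)"
  proof (rule Lim_null_comparison[THEN LIM_zero_cancel])
    have "norm (u t - u 0) \<le> t * j 0" if "0 < t" for t
    proof -
      have "norm (u t - u 0) \<le> t * (j 0 - j t)"
        using descent_bound[OF u, of 0 t] that by (simp add: j_def)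
      also have "\<dots> \<le> t * j 0" using that jJ[of t] by (simp add: mult_left_mono)
      finally show ?thesis .
    qed
    then show "eventually (\<lambda>t. norm (u t - u 0) \<le> t * j 0) (at_right 0)"
      by (simp add: eventually_at_right_less[THEN eventually_mono])
    have "((\<lambda>t. t * j 0) \<longlongrightarrow> 0 * j 0) (at_right 0)" by (intro tendsto_intros)
    then show "((\<lambda>t. t * j 0) \<longlongrightarrow> 0) (at_right 0)" by simp
  qed
  ultimately show ?thesis using L1 by (simp add: energetic_solution_def)
qed

theorem theorem1p1:
  fixes J :: "'a::{real_inner, banach} \<Rightarrow> ennreal" and u0 :: 'a
  assumes "convex_functional J"
    and "lower_semicontinuous J"
    and "pos_homogeneous J"
    and "closure (eff_domain J) = UNIV"
    and "J u0 < \<infinity>"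
  shows "\<exists>!u :: real \<Rightarrow> 'a. u \<in> extensional {0..} \<and>
           energetic_solution J u \<and> left_continuous u \<and> u 0 = u0"
proof (rule ex_ex1I)
  have J: "convex_energy (eff_domain J) (\<lambda>x. enn2real (J x))"
    using assms(1,2) by (rule convex_energy_of_functional)
  interpret convex_energy "eff_domain J" "\<lambda>x. enn2real (J x)" by (rule J)
  have u0: "u0 \<in> eff_domain J" using assms(5) by (simp add: eff_domain_def)
  obtain v where v: "stable_descent {0..} v" "v 0 = u0" and lv: "\<And>t. 0 < t \<Longrightarrow> (v \<longlongrightarrow> v t) (at_left t)"
    using left_continuous_descent_exists[OF u0] by metis
  \<comment> \<open>Restriction normalises the irrelevant values at negative times.\<close>
  define u where "u = restrict v {0..}"
  have uv: "u t = v t" if "0 \<le> t" for t using that by (simp add: u_def)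
  have "stable_descent {0..} u" using v(1) uv by (simp add: stable_descent_def)
  then have "energetic_solution J u" by (rule stable_descent_imp_energetic_solution[OF J])
  moreover have "left_continuous u"
    unfolding left_continuous_def
  proof (intro allI impI)
    fix t :: real assume t: "0 < t"
    have "eventually (\<lambda>s. v s = u s) (at_left t)"
      using eventually_at_left_real[OF t] by eventually_elim (simp add: uv)
    then show "(u \<longlongrightarrow> u t) (at_left t)"
      using lv[OF t] t by (auto simp: uv intro: Lim_transform_eventually)
  qed
  ultimately show "\<exists>u. u \<in> extensional {0..} \<and> energetic_solution J u \<and> left_continuous u \<and> u 0 = u0"
    using v(2) uv by (intro exI[of _ u]) (simp add: u_def)
  fix u w
  assume u: "u \<in> extensional {0..} \<and> energetic_solution J u \<and> left_continuous u \<and> u 0 = u0"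
    and w: "w \<in> extensional {0..} \<and> energetic_solution J w \<and> left_continuous w \<and> w 0 = u0"
  have dom: "eff_domain J \<noteq> {}" using u0 by blast
  have "((\<lambda>t. u t - w t) \<longlongrightarrow> u 0 - w 0) (at_right 0)"
    using u w by (intro tendsto_diff) (auto simp: energetic_solution_def)
  then have "((\<lambda>t. u t - w t) \<longlongrightarrow> 0) (at_right 0)" using u w by simp
  then have "u t = w t" if "0 < t" for t
    using stable_descent_unique[of u w t] that u w
      energetic_solution_imp_stable_descent[OF J _ dom] by (auto simp: left_continuous_def)
  then have "u t = w t" if "0 \<le> t" for t using that u w by (cases "t = 0") auto
  then show "u = w" using u w by (intro extensionalityI[of _ "{0..}"]) auto
qed

end
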